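(* Let $\mathcal{L}$ be a special ample line bundle on $V$. Then the canonical map $$H^0(V, \mathcal{L}) \otimes H^0(V, \mathcal{L}) \otimes \cdots \otimes H^0(V, \mathcal{L}) \longrightarrow H^0(V, \mathcal{L}^m)$$ ($m$ tensor factors on the left) is a surjection for all $m \geq 1$, i.e., $\mathcal{L}$ is projectively normal.
   Context: Let $\Phi$ be an irreducible, reduced (finite, crystallographic) root system of rank $n$, with set of roots $\Delta$, root lattice $Y$, weight lattice $X \supseteq Y$, coroot lattice $X^\vee$ and coweight lattice $Y^\vee\supseteq X^\vee$, and pairing $\langle\,,\rangle : X \times X^\vee \to \mathbb{Z}$ extended to $(X\otimes_{\mathbb Z}\mathbb{R})\times X^\vee$. Let $F$ be the Weyl fan in $Y^\vee \otimes_{\mathbb Z} \mathbb{R}$ (cut out by the root hyperplanes) and $F_n$ the set of its maximal cones (Weyl chambers). For $\sigma\in F_n$ let $\{\alpha_{i,\sigma} : 1\le i\le n\}$ be the corresponding simple roots; $x \in X\otimes_{\mathbb Z}\mathbb{R}$ is $\sigma$-dominant if $\langle x, \alpha_{i,\sigma}^\vee\rangle \ge 0$ for all $i$. For adjacent chambers $\sigma,\sigma'$, $\alpha_{\sigma,\sigma'}\in\Delta$ is the unique root positive on $\sigma$ and negative on $\sigma'$. $V$ is the complex toric variety with fan $F$ and lattice $Y^\vee$; it is smooth and projective, with torus $T_1 = \operatorname{Spec}\mathbb{C}[Y]$. The torus $T = \operatorname{Spec}\mathbb{C}[X]$ acts on $V$ via the projection $T \twoheadrightarrow T_1$. Isomorphism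 classes of $T$-equivariant ample line bundles on $V$ correspond bijectively, in the usual way, to ample polytopes: convex polytopes $P \subset X\otimes_{\mathbb Z}\mathbb{R}$ with vertices given by a set $\{\mu_\sigma : \sigma\in F_n\} \subset X$ such that for adjacent $\sigma,\sigma'$, $\mu_\sigma - \mu_{\sigma'} = r_{\sigma,\sigma'}\alpha_{\sigma,\sigma'}$ with $r_{\sigma,\sigma'} \in \mathbb{Z}_{>0}$. Put $\Lambda(P) := P \cap (\mu_\sigma + Y)$ (independent of $\sigma$). The sign conventions are such that, if $\mathcal{L}$ corresponds to $P$, a character $x\in X$ occurs in $H^0(V,\mathcal{L})$ iff $x\in\Lambda(P)$, and then with multiplicity one. The line bundle is called special ample if its polytope is special, i.e. $\mu_\sigma$ is $\sigma$-dominant for every $\sigma\in F_n$. *)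

theory Defs
  imports "HOL-Analysis.Analysis" "HOL-Library.Function_Algebras"
begin

section \<open>Root systems, lattices and Weyl chambers\<close>

text \<open>
  The ambient Euclidean space is the real span of the weight lattice. Its inner product is invariant
  under the Weyl group, because the reflections below are orthogonal, and it is used to identify the
  space with its dual: the coroot of \<open>\<alpha>\<close> is \<open>2 \<alpha> / (\<alpha> \<bullet> \<alpha>)\<close>, and the real span of the coweight
  lattice, in which the Weyl fan lives, is again the ambient space.
\<close>

definition coroot_pairing :: "'a::euclidean_space \<Rightarrow> 'a \<Rightarrow> real" where
  "coroot_pairing x \<alpha> = 2 * (x \<bullet> \<alpha>) / (\<alpha> \<bullet> \<alpha>)"

definition root_system :: "'a::euclidean_space set \<Rightarrow> bool" where
  "root_system \<Delta> \<longleftrightarrow>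
     finite \<Delta> \<and> 0 \<notin> \<Delta> \<and> span \<Delta> = UNIV \<and>
     (\<forall>\<alpha>\<in>\<Delta>. \<forall>\<beta>\<in>\<Delta>. \<beta> - coroot_pairing \<beta> \<alpha> *\<^sub>R \<alpha> \<in> \<Delta>) \<and>
     (\<forall>\<alpha>\<in>\<Delta>. \<forall>\<beta>\<in>\<Delta>. coroot_pairing \<beta> \<alpha> \<in> \<int>)"

definition reduced_roots :: "'a::euclidean_space set \<Rightarrow> bool" where
  "reduced_roots \<Delta> \<longleftrightarrow> (\<forall>\<alpha>\<in>\<Delta>. \<forall>c. c *\<^sub>R \<alpha> \<in> \<Delta> \<longrightarrow> c = 1 \<or> c = - 1)"

definition irreducible_roots :: "'a::euclidean_space set \<Rightarrow> bool" where
  "irreducible_roots \<Delta> \<longleftrightarrow>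
     \<Delta> \<noteq> {} \<and>
     \<not> (\<exists>A B. A \<noteq> {} \<and> B \<noteq> {} \<and> A \<union> B = \<Delta> \<and> (\<forall>\<alpha>\<in>A. \<forall>\<beta>\<in>B. \<alpha> \<bullet> \<beta> = 0))"

definition root_lattice :: "'a::euclidean_space set \<Rightarrow> 'a set" where
  "root_lattice \<Delta> = {\<Sum>\<alpha>\<in>\<Delta>. of_int (k \<alpha>) *\<^sub>R \<alpha> | k :: 'a \<Rightarrow> int. True}"

definition weight_lattice :: "'a::euclidean_space set \<Rightarrow> 'a set" where
  "weight_lattice \<Delta> = {x. \<forall>\<alpha>\<in>\<Delta>. coroot_pairing x \<alpha> \<in> \<int>}"

definition weyl_chambers :: "'a::euclidean_space set \<Rightarrow> 'a set set" where
  "weyl_chambers \<Delta> = closure ` components (- (\<Union>\<alpha>\<in>\<Delta>. {v. v \<bullet> \<alpha> = 0}))"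

definition positive_roots :: "'a::euclidean_space set \<Rightarrow> 'a set \<Rightarrow> 'a set" where
  "positive_roots \<Delta> \<sigma> = {\<alpha>\<in>\<Delta>. \<forall>v\<in>\<sigma>. 0 \<le> v \<bullet> \<alpha>}"

definition simple_roots :: "'a::euclidean_space set \<Rightarrow> 'a set \<Rightarrow> 'a set" where
  "simple_roots \<Delta> \<sigma> =
     {\<alpha> \<in> positive_roots \<Delta> \<sigma>.
        \<not> (\<exists>\<beta>\<in>positive_roots \<Delta> \<sigma>. \<exists>\<gamma>\<in>positive_roots \<Delta> \<sigma>. \<alpha> = \<beta> + \<gamma>)}"

definition dominant :: "'a::euclidean_space set \<Rightarrow> 'a set \<Rightarrow> 'a \<Rightarrow> bool" where
  "dominant \<Delta> \<sigma> x \<longleftrightarrow> (\<forall>\<alpha>\<in>simple_roots \<Delta> \<sigma>. 0 \<le> coroot_pairing x \<alpha>)"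


section \<open>The toric variety of the Weyl fan\<close>

text \<open>
  The variety is treated through its complex points. The lattice dual to the coweight lattice is the
  root lattice \<open>Y\<close>, so a cone \<open>\<tau>\<close> of the fan has the affine chart
  \<open>U\<^sub>\<tau> = Spec \<complex>[\<tau>\<^sup>\<or> \<inter> Y]\<close>, whose points are the monoid homomorphisms from \<open>\<tau>\<^sup>\<or> \<inter> Y\<close> to the
  multiplicative monoid \<open>\<complex>\<close>. Such homomorphisms are extended by \<open>0\<close> outside \<open>\<tau>\<^sup>\<or> \<inter> Y\<close>, which makes
  them unique as HOL functions.
\<close>

definition dual_monoid :: "'a::euclidean_space set \<Rightarrow> 'a set \<Rightarrow> 'a set" where
  "dual_monoid \<Delta> \<tau> = {y \<in> root_lattice \<Delta>. \<forall>v\<in>\<tau>. 0 \<le> v \<bullet> y}"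

definition chart :: "'a::euclidean_space set \<Rightarrow> 'a set \<Rightarrow> ('a \<Rightarrow> complex) set" where
  "chart \<Delta> \<tau> =
     {p. p 0 = 1 \<and>
         (\<forall>x\<in>dual_monoid \<Delta> \<tau>. \<forall>y\<in>dual_monoid \<Delta> \<tau>. p (x + y) = p x * p y) \<and>
         (\<forall>y. y \<notin> dual_monoid \<Delta> \<tau> \<longrightarrow> p y = 0)}"

text \<open>
  The coordinate ring \<open>\<complex>[\<tau>\<^sup>\<or> \<inter> Y]\<close>, with its elements regarded as functions on the points of the
  chart. Values outside the chart are unconstrained.
\<close>

definition regular :: "'a::euclidean_space set \<Rightarrow> 'a set \<Rightarrow> (('a \<Rightarrow> complex) \<Rightarrow> complex) set" where
  "regular \<Delta> \<tau> =
     {f. \<exists>A c. finite A \<and> A \<subseteq> dual_monoid \<Delta> \<tau> \<and>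
               (\<forall>p\<in>chart \<Delta> \<tau>. f p = (\<Sum>y\<in>A. c y * p y))}"

text \<open>
  For cones \<open>\<tau> \<subseteq> \<sigma>\<close>, \<open>chart_map \<Delta> \<sigma>\<close> maps the chart of \<open>\<tau>\<close> to the chart of \<open>\<sigma>\<close>; for a face it is the
  open embedding along which the charts are glued. Every cone of the fan is a face of a Weyl chamber,
  so the charts of the chambers suffice, glued along the charts of their pairwise intersections.
\<close>

definition chart_map :: "'a::euclidean_space set \<Rightarrow> 'a set \<Rightarrow> ('a \<Rightarrow> complex) \<Rightarrow> 'a \<Rightarrow> complex" where
  "chart_map \<Delta> \<sigma> p = (\<lambda>y. if y \<in> dual_monoid \<Delta> \<sigma> then p y else 0)"

definition gluing ::
  "'a::euclidean_space set \<Rightarrow> (('a set \<times> ('a \<Rightarrow> complex)) \<times> ('a set \<times> ('a \<Rightarrow> complex))) set" where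
  "gluing \<Delta> =
     {((\<sigma>, chart_map \<Delta> \<sigma> q), (\<sigma>', chart_map \<Delta> \<sigma>' q)) | \<sigma> \<sigma>' q.
        \<sigma> \<in> weyl_chambers \<Delta> \<and> \<sigma>' \<in> weyl_chambers \<Delta> \<and> q \<in> chart \<Delta> (\<sigma> \<inter> \<sigma>')}"

definition toric_variety ::
  "'a::euclidean_space set \<Rightarrow> ('a set \<times> ('a \<Rightarrow> complex)) set set" where
  "toric_variety \<Delta> = Sigma (weyl_chambers \<Delta>) (chart \<Delta>) // gluing \<Delta>"

definition point ::
  "'a::euclidean_space set \<Rightarrow> 'a set \<Rightarrow> ('a \<Rightarrow> complex) \<Rightarrow> ('a set \<times> ('a \<Rightarrow> complex)) set" where
  "point \<Delta> \<sigma> p = gluing \<Delta> `` {(\<sigma>, p)}"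

definition zariski_open ::
  "'a::euclidean_space set \<Rightarrow> ('a set \<times> ('a \<Rightarrow> complex)) set set \<Rightarrow> bool" where
  "zariski_open \<Delta> U \<longleftrightarrow>
     U \<subseteq> toric_variety \<Delta> \<and>
     (\<forall>\<sigma>\<in>weyl_chambers \<Delta>. \<forall>p\<in>chart \<Delta> \<sigma>. point \<Delta> \<sigma> p \<in> U \<longrightarrow>
        (\<exists>f\<in>regular \<Delta> \<sigma>. f p \<noteq> 0 \<and> (\<forall>q\<in>chart \<Delta> \<sigma>. f q \<noteq> 0 \<longrightarrow> point \<Delta> \<sigma> q \<in> U)))"

text \<open>
  The points of the torus \<open>T = Spec \<complex>[X]\<close> are the group homomorphisms from \<open>X\<close> to the nonzero complex
  numbers, again extended by \<open>0\<close>. The projection from \<open>T\<close> to \<open>Spec \<complex>[Y]\<close> is restriction to \<open>Y \<subseteq> X\<close>.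
\<close>

definition torus :: "'a::euclidean_space set \<Rightarrow> ('a \<Rightarrow> complex) set" where
  "torus \<Delta> =
     {t. t 0 = 1 \<and>
         (\<forall>x\<in>weight_lattice \<Delta>. \<forall>y\<in>weight_lattice \<Delta>. t (x + y) = t x * t y) \<and>
         (\<forall>x. x \<notin> weight_lattice \<Delta> \<longrightarrow> t x = 0)}"

definition torus_one :: "'a::euclidean_space set \<Rightarrow> 'a \<Rightarrow> complex" where
  "torus_one \<Delta> = (\<lambda>x. if x \<in> weight_lattice \<Delta> then 1 else 0)"

definition translate :: "('a \<Rightarrow> complex) \<Rightarrow> ('a \<Rightarrow> complex) \<Rightarrow> 'a \<Rightarrow> complex" where
  "translate t p = (\<lambda>y. t y * p y)"


section \<open>Equivariant line bundles\<close>

text \<open>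
  The charts of the Weyl chambers are affine spaces, so every line bundle on the variety is trivial on
  each of them. It is therefore given by a cocycle of regular transition functions: a point of the
  total space over \<open>q\<close> in the overlap of the charts of \<open>\<sigma>\<close> and \<open>\<sigma>'\<close> has fibre coordinates
  \<open>z\<^sub>\<sigma> = trans \<sigma> \<sigma>' q * z\<^sub>\<sigma>'\<close>. The torus acts on the total space, linearly on the fibres and over its
  action on the variety, by \<open>t (p, z\<^sub>\<sigma>) = (t p, act \<sigma> t p * z\<^sub>\<sigma>)\<close>. The cocycle conditions make the
  transition functions and the factors \<open>act\<close> invertible.
\<close>

record 'a torus_bundle =
  trans :: "'a set \<Rightarrow> 'a set \<Rightarrow> ('a \<Rightarrow> complex) \<Rightarrow> complex"
  act :: "'a set \<Rightarrow> ('a \<Rightarrow> complex) \<Rightarrow> ('a \<Rightarrow> complex) \<Rightarrow> complex"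

definition line_bundle :: "'a::euclidean_space set \<Rightarrow> 'a torus_bundle \<Rightarrow> bool" where
  "line_bundle \<Delta> L \<longleftrightarrow>
     (\<forall>\<sigma>\<in>weyl_chambers \<Delta>. \<forall>\<sigma>'\<in>weyl_chambers \<Delta>. trans L \<sigma> \<sigma>' \<in> regular \<Delta> (\<sigma> \<inter> \<sigma>')) \<and>
     (\<forall>\<sigma>\<in>weyl_chambers \<Delta>. \<forall>p\<in>chart \<Delta> \<sigma>. trans L \<sigma> \<sigma> p = 1) \<and>
     (\<forall>\<sigma>\<in>weyl_chambers \<Delta>. \<forall>\<sigma>'\<in>weyl_chambers \<Delta>. \<forall>\<sigma>''\<in>weyl_chambers \<Delta>.
        \<forall>p\<in>chart \<Delta> (\<sigma> \<inter> \<sigma>' \<inter> \<sigma>'').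
          trans L \<sigma> \<sigma>' (chart_map \<Delta> (\<sigma> \<inter> \<sigma>') p) * trans L \<sigma>' \<sigma>'' (chart_map \<Delta> (\<sigma>' \<inter> \<sigma>'') p)
          = trans L \<sigma> \<sigma>'' (chart_map \<Delta> (\<sigma> \<inter> \<sigma>'') p))"

text \<open>Regular functions on the product of the torus and a chart are elements of \<open>\<complex>[X] \<otimes> \<complex>[\<sigma>\<^sup>\<or> \<inter> Y]\<close>.\<close>

definition regular_on_torus_times ::
  "'a::euclidean_space set \<Rightarrow> 'a set \<Rightarrow> (('a \<Rightarrow> complex) \<Rightarrow> ('a \<Rightarrow> complex) \<Rightarrow> complex) set" where
  "regular_on_torus_times \<Delta> \<sigma> =
     {f. \<exists>A c. finite A \<and> A \<subseteq> weight_lattice \<Delta> \<times> dual_monoid \<Delta> \<sigma> \<and>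
               (\<forall>t\<in>torus \<Delta>. \<forall>p\<in>chart \<Delta> \<sigma>. f t p = (\<Sum>(x, y)\<in>A. c (x, y) * t x * p y))}"

definition equivariant_line_bundle :: "'a::euclidean_space set \<Rightarrow> 'a torus_bundle \<Rightarrow> bool" where
  "equivariant_line_bundle \<Delta> L \<longleftrightarrow>
     line_bundle \<Delta> L \<and>
     (\<forall>\<sigma>\<in>weyl_chambers \<Delta>. act L \<sigma> \<in> regular_on_torus_times \<Delta> \<sigma>) \<and>
     (\<forall>\<sigma>\<in>weyl_chambers \<Delta>. \<forall>p\<in>chart \<Delta> \<sigma>. act L \<sigma> (torus_one \<Delta>) p = 1) \<and>
     (\<forall>\<sigma>\<in>weyl_chambers \<Delta>. \<forall>t\<in>torus \<Delta>. \<forall>t'\<in>torus \<Delta>. \<forall>p\<in>chart \<Delta> \<sigma>.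
        act L \<sigma> (translate t t') p = act L \<sigma> t (translate t' p) * act L \<sigma> t' p) \<and>
     (\<forall>\<sigma>\<in>weyl_chambers \<Delta>. \<forall>\<sigma>'\<in>weyl_chambers \<Delta>. \<forall>t\<in>torus \<Delta>. \<forall>q\<in>chart \<Delta> (\<sigma> \<inter> \<sigma>').
        act L \<sigma> t (chart_map \<Delta> \<sigma> q) * trans L \<sigma> \<sigma>' q
        = trans L \<sigma> \<sigma>' (translate t q) * act L \<sigma>' t (chart_map \<Delta> \<sigma>' q))"

definition bundle_power :: "'a torus_bundle \<Rightarrow> nat \<Rightarrow> 'a torus_bundle" where
  "bundle_power L m =
     \<lparr>trans = (\<lambda>\<sigma> \<sigma>' q. trans L \<sigma> \<sigma>' q ^ m), act = (\<lambda>\<sigma> t p. act L \<sigma> t p ^ m)\<rparr>"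

type_synonym 'a bundle_section = "'a set \<Rightarrow> ('a \<Rightarrow> complex) \<Rightarrow> complex"

text \<open>
  A global section is the family of its fibre coordinates in the charts, set to \<open>0\<close> at arguments that
  are not points of charts of chambers.
\<close>

definition global_sections :: "'a::euclidean_space set \<Rightarrow> 'a torus_bundle \<Rightarrow> 'a bundle_section set" where
  "global_sections \<Delta> L =
     {s. (\<forall>\<sigma>\<in>weyl_chambers \<Delta>. s \<sigma> \<in> regular \<Delta> \<sigma>) \<and>
         (\<forall>\<sigma>\<in>weyl_chambers \<Delta>. \<forall>\<sigma>'\<in>weyl_chambers \<Delta>. \<forall>q\<in>chart \<Delta> (\<sigma> \<inter> \<sigma>').
            s \<sigma> (chart_map \<Delta> \<sigma> q) = trans L \<sigma> \<sigma>' q * s \<sigma>' (chart_map \<Delta> \<sigma>' q)) \<and>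
         (\<forall>\<sigma> p. \<not> (\<sigma> \<in> weyl_chambers \<Delta> \<and> p \<in> chart \<Delta> \<sigma>) \<longrightarrow> s \<sigma> p = 0)}"

definition nonvanishing_locus ::
  "'a::euclidean_space set \<Rightarrow> 'a bundle_section \<Rightarrow> ('a set \<times> ('a \<Rightarrow> complex)) set set" where
  "nonvanishing_locus \<Delta> s =
     {point \<Delta> \<sigma> p | \<sigma> p. \<sigma> \<in> weyl_chambers \<Delta> \<and> p \<in> chart \<Delta> \<sigma> \<and> s \<sigma> p \<noteq> 0}"

text \<open>
  Ampleness as defined in EGA II, 4.5: the nonvanishing loci of the global sections of positive powers
  of the bundle form a base of the Zariski topology.
\<close>

definition ample :: "'a::euclidean_space set \<Rightarrow> 'a torus_bundle \<Rightarrow> bool" where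
  "ample \<Delta> L \<longleftrightarrow>
     (\<forall>U. zariski_open \<Delta> U \<longrightarrow>
       (\<forall>P\<in>U. \<exists>k\<ge>1. \<exists>s\<in>global_sections \<Delta> (bundle_power L k).
          P \<in> nonvanishing_locus \<Delta> s \<and> nonvanishing_locus \<Delta> s \<subseteq> U))"

text \<open>
  The vertex \<open>\<mu> \<sigma>\<close> of the polytope of \<open>L\<close> is the character by which the torus acts on the fibre over
  the fixed point of the chart of \<open>\<sigma>\<close>. This fits the convention that a character \<open>x\<close> of \<open>T\<close> occurs in
  the space of global sections precisely when \<open>x\<close> is in the polytope and in the coset
  \<open>\<mu> \<sigma> + Y\<close>: \<open>T\<close> acts on sections by \<open>(t s)(p) = t s(t\<^sup>-\<^sup>1 p)\<close>, the function \<open>p \<mapsto> p y\<close> then has weight \<open>- y\<close>, and the weights of sections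
  over the chart of \<open>\<sigma>\<close> form the set \<open>\<mu> \<sigma> - (\<sigma>\<^sup>\<or> \<inter> Y)\<close>.
\<close>

definition fixed_point :: "'a::zero \<Rightarrow> complex" where
  "fixed_point = (\<lambda>y. if y = 0 then 1 else 0)"

definition polytope_vertices ::
  "'a::euclidean_space set \<Rightarrow> 'a torus_bundle \<Rightarrow> ('a set \<Rightarrow> 'a) \<Rightarrow> bool" where
  "polytope_vertices \<Delta> L \<mu> \<longleftrightarrow>
     (\<forall>\<sigma>\<in>weyl_chambers \<Delta>.
        \<mu> \<sigma> \<in> weight_lattice \<Delta> \<and> (\<forall>t\<in>torus \<Delta>. act L \<sigma> t fixed_point = t (\<mu> \<sigma>)))"

definition special_ample :: "'a::euclidean_space set \<Rightarrow> 'a torus_bundle \<Rightarrow> bool" where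
  "special_ample \<Delta> L \<longleftrightarrow>
     equivariant_line_bundle \<Delta> L \<and> ample \<Delta> L \<and>
     (\<exists>\<mu>. polytope_vertices \<Delta> L \<mu> \<and> (\<forall>\<sigma>\<in>weyl_chambers \<Delta>. dominant \<Delta> \<sigma> (\<mu> \<sigma>)))"


section \<open>Tensor powers and the multiplication map\<close>

text \<open>
  The \<open>m\<close>-th tensor power of a space of sections is the free complex vector space on the lists of
  \<open>m\<close> sections modulo the multilinearity relations.
\<close>

definition basis_vector :: "'b list \<Rightarrow> 'b list \<Rightarrow> complex" where
  "basis_vector w = (\<lambda>v. if v = w then 1 else 0)"

definition free_space ::
  "nat \<Rightarrow> 'a bundle_section set \<Rightarrow> ('a bundle_section list \<Rightarrow> complex) set" where
  "free_space m H =
     {\<phi>. finite {w. \<phi> w \<noteq> 0} \<and> (\<forall>w. \<phi> w \<noteq> 0 \<longrightarrow> length w = m \<and> set w \<subseteq> H)}"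

definition multilinear_relations ::
  "nat \<Rightarrow> 'a bundle_section set \<Rightarrow> ('a bundle_section list \<Rightarrow> complex) set" where
  "multilinear_relations m H =
     module.span (\<lambda>c \<phi> w. c * \<phi> w)
       ({basis_vector (u @ (a + b) # v) - basis_vector (u @ a # v) - basis_vector (u @ b # v)
           | u v a b. set u \<subseteq> H \<and> set v \<subseteq> H \<and> a \<in> H \<and> b \<in> H \<and> length u + length v + 1 = m}
        \<union>
        {(\<lambda>w. basis_vector (u @ (\<lambda>\<sigma> p. c * a \<sigma> p) # v) w - c * basis_vector (u @ a # v) w)
           | u v a c. set u \<subseteq> H \<and> set v \<subseteq> H \<and> a \<in> H \<and> length u + length v + 1 = m})"

definition tensor_power ::
  "nat \<Rightarrow> 'a bundle_section set \<Rightarrow> ('a bundle_section list \<Rightarrow> complex) set set" where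
  "tensor_power m H =
     free_space m H //
       {(\<phi>, \<psi>). \<phi> \<in> free_space m H \<and> \<psi> \<in> free_space m H \<and> \<phi> - \<psi> \<in> multilinear_relations m H}"

definition multiply :: "('a bundle_section list \<Rightarrow> complex) \<Rightarrow> 'a bundle_section" where
  "multiply \<phi> = (\<lambda>\<sigma> p. \<Sum>w | \<phi> w \<noteq> 0. \<phi> w * (\<Prod>s\<leftarrow>w. s \<sigma> p))"

text \<open>
  \<open>multiply\<close> is constant on the classes that make up the tensor power; \<open>the_elem\<close> picks its value.
\<close>

definition canonical_map :: "('a bundle_section list \<Rightarrow> complex) set \<Rightarrow> 'a bundle_section" where
  "canonical_map \<xi> = the_elem (multiply ` \<xi>)"

end

theory Submission
  imports Defs "HOL-Computational_Algebra.Fundamental_Theorem_Algebra"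
begin

text \<open>
  Restricted to the torus, a global section is a combination of characters, so the sections of \<open>L\<close> have
  a basis indexed by the lattice points of the polytope, and surjectivity means that every lattice
  point \<open>x\<close> of \<open>m P\<close> is a sum of \<open>m\<close> lattice points of \<open>P\<close>. Take a chamber \<open>\<sigma>\<close> for which \<open>x\<close> is dominant and
  start with \<open>m\<close> copies of \<open>\<mu> \<sigma>\<close>. While the sum differs from \<open>x\<close>, the difference pairs positively with
  some simple root \<open>\<alpha>\<close> occurring in it; since \<open>x\<close> is dominant, one of the \<open>m\<close> points pairs positively with
  \<open>\<alpha>\<close> too, and \<open>\<alpha>\<close> can be subtracted from it. That this does not leave \<open>P\<close> is the heart of the proof, and
  the only place where dominance of the vertices is used.
\<close>

section \<open>Roots, chambers and fundamental coweights\<close>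

text \<open>Geometry is traded for combinatorics twice. The factor \<open>act\<close> has no zeros,
  which makes it constant along each chart; this forces the transition functions to be monomials and
  gives every section an expansion indexed by lattice points. Ampleness is used only to separate two
  torus-fixed points, which puts the vertices into the polytope and makes them distinct. The
  polytope is never handled as a convex hull: \<open>x\<close> is one of its lattice points when, in
  every chamber, the vertex minus \<open>x\<close> has non-negative integral coordinates in the
  simple roots. The obstacle is that subtracting \<alpha> from a point must be justified in all
  chambers at once. Where \<alpha> is positive this is harmless. Elsewhere -\<alpha> is a positive
  root that pairs negatively with the point, and such chambers are reached by passing through
  adjacent ones until that root is simple. The excess of the sum over \<open>x\<close>, in contrast,
  is watched only in the one chamber for which \<open>x\<close> is dominant.\<close>

definition reflect :: "'a::euclidean_space \<Rightarrow> 'a \<Rightarrow> 'a" where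
  "reflect \<alpha> x = x - coroot_pairing x \<alpha> *\<^sub>R \<alpha>"

lemma linear_reflect: "linear (reflect \<alpha>)"
  unfolding reflect_def coroot_pairing_def
  by (rule linearI) (auto simp: inner_add_left algebra_simps add_divide_distrib)

lemma reflect_add: "reflect \<alpha> (x + y) = reflect \<alpha> x + reflect \<alpha> y"
  by (rule linear_add[OF linear_reflect])

lemma reflect_inner_swap: "reflect \<alpha> x \<bullet> y = x \<bullet> reflect \<alpha> y"
  by (simp add: reflect_def coroot_pairing_def inner_diff_left inner_diff_right inner_commute)

lemma reflect_reflect [simp]: "reflect \<alpha> (reflect \<alpha> x) = x"
  by (cases "\<alpha> = 0") (auto simp: reflect_def coroot_pairing_def inner_diff_left algebra_simps
      diff_divide_distrib)

lemma reflect_self: "\<alpha> \<noteq> 0 \<Longrightarrow> reflect \<alpha> \<alpha> = - \<alpha>"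
  by (simp add: reflect_def coroot_pairing_def algebra_simps scaleR_2)

lemma reflect_inner_self: "\<alpha> \<noteq> 0 \<Longrightarrow> reflect \<alpha> x \<bullet> \<alpha> = - (x \<bullet> \<alpha>)"
  by (simp add: reflect_inner_swap reflect_self)

lemma reflect_orthogonal: "x \<bullet> \<alpha> = 0 \<Longrightarrow> reflect \<alpha> x = x"
  by (simp add: reflect_def coroot_pairing_def)

lemma coroot_pairing_pos_iff: "\<alpha> \<noteq> 0 \<Longrightarrow> 0 < coroot_pairing x \<alpha> \<longleftrightarrow> 0 < x \<bullet> \<alpha>"
  by (simp add: coroot_pairing_def pos_less_divide_eq)

lemma coroot_pairing_nonneg_iff: "\<alpha> \<noteq> 0 \<Longrightarrow> 0 \<le> coroot_pairing x \<alpha> \<longleftrightarrow> 0 \<le> x \<bullet> \<alpha>"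
  by (simp add: coroot_pairing_def pos_le_divide_eq)

lemma coroot_pairing_diff: "coroot_pairing (x - y) \<alpha> = coroot_pairing x \<alpha> - coroot_pairing y \<alpha>"
  by (simp add: coroot_pairing_def inner_diff_left diff_divide_distrib right_diff_distrib)

lemma coroot_pairing_self: "\<alpha> \<noteq> 0 \<Longrightarrow> coroot_pairing \<alpha> \<alpha> = 2"
  by (simp add: coroot_pairing_def)

text \<open>Finitely many hyperplanes have measure zero. Besides regular vectors this provides the
  direction that separates exponents in \<open>exp_independent\<close>.\<close>

lemma exists_avoiding_hyperplanes:
  fixes A :: "'a::euclidean_space set"
  assumes "finite A" "0 \<notin> A"
  shows "\<exists>v. \<forall>a\<in>A. v \<bullet> a \<noteq> 0"
proof -
  have "negligible (\<Union>a\<in>A. {v. a \<bullet> v = 0})"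
    using assms by (intro negligible_Union) (auto intro!: negligible_hyperplane)
  then have "(\<Union>a\<in>A. {v. a \<bullet> v = 0}) \<noteq> UNIV"
    using non_negligible_UNIV by metis
  then show ?thesis by (auto simp: inner_commute)
qed

section \<open>Differences of roots\<close>

locale reduced_root_system =
  fixes \<Delta> :: "'a::euclidean_space set"
  assumes root_system: "root_system \<Delta>" and reduced: "reduced_roots \<Delta>"
begin

lemma finite_roots: "finite \<Delta>" and zero_not_root: "0 \<notin> \<Delta>" and span_roots: "span \<Delta> = UNIV"
  using root_system by (auto simp: root_system_def)

lemma root_nonzero: "\<alpha> \<in> \<Delta> \<Longrightarrow> \<alpha> \<noteq> 0"
  using zero_not_root by auto

lemma reflect_root: "\<alpha> \<in> \<Delta> \<Longrightarrow> \<beta> \<in> \<Delta> \<Longrightarrow> reflect \<alpha> \<beta> \<in> \<Delta>"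
  using root_system by (auto simp: root_system_def reflect_def)

lemma pairing_roots_Ints: "\<alpha> \<in> \<Delta> \<Longrightarrow> \<beta> \<in> \<Delta> \<Longrightarrow> coroot_pairing \<beta> \<alpha> \<in> \<int>"
  using root_system by (auto simp: root_system_def)

lemma minus_root: "\<alpha> \<in> \<Delta> \<Longrightarrow> - \<alpha> \<in> \<Delta>"
  using reflect_root[of \<alpha> \<alpha>] reflect_self[of \<alpha>] root_nonzero by auto

lemma minus_root_iff: "- \<alpha> \<in> \<Delta> \<longleftrightarrow> \<alpha> \<in> \<Delta>"
  using minus_root[of \<alpha>] minus_root[of "- \<alpha>"] by auto

lemma proportional_roots: "\<alpha> \<in> \<Delta> \<Longrightarrow> c *\<^sub>R \<alpha> \<in> \<Delta> \<Longrightarrow> c = 1 \<or> c = - 1"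
  using reduced by (auto simp: reduced_roots_def)

text \<open>Both integral pairings of the two roots are positive. If both were at least 2, the norm
  of \<open>\<alpha> - \<beta>\<close> would vanish; so one of them is 1, and the corresponding
  reflection produces the difference up to sign.\<close>

lemma root_diff:
  assumes "\<alpha> \<in> \<Delta>" "\<beta> \<in> \<Delta>" "\<alpha> \<noteq> \<beta>" "0 < \<alpha> \<bullet> \<beta>"
  shows "\<alpha> - \<beta> \<in> \<Delta>"
proof -
  note nz = root_nonzero[OF assms(1)] root_nonzero[OF assms(2)]
  obtain m n :: int where m: "coroot_pairing \<alpha> \<beta> = m" and n: "coroot_pairing \<beta> \<alpha> = n"
    using pairing_roots_Ints assms by (meson Ints_cases)
  have pos: "m > 0" "n > 0"
    using coroot_pairing_pos_iff[OF nz(2), of \<alpha>] coroot_pairing_pos_iff[OF nz(1), of \<beta>] assms(4) m n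
    by (auto simp: inner_commute)
  have "\<not> (m \<ge> 2 \<and> n \<ge> 2)"
  proof
    assume mn: "m \<ge> 2 \<and> n \<ge> 2"
    have "\<alpha> \<bullet> \<beta> \<ge> \<beta> \<bullet> \<beta>" "\<alpha> \<bullet> \<beta> \<ge> \<alpha> \<bullet> \<alpha>"
    proof -
      have "2 * (\<alpha> \<bullet> \<beta>) = m * (\<beta> \<bullet> \<beta>)" "2 * (\<beta> \<bullet> \<alpha>) = n * (\<alpha> \<bullet> \<alpha>)"
        using m n nz by (auto simp: coroot_pairing_def field_simps)
      moreover have "real_of_int m * (\<beta> \<bullet> \<beta>) \<ge> 2 * (\<beta> \<bullet> \<beta>)" "real_of_int n * (\<alpha> \<bullet> \<alpha>) \<ge> 2 * (\<alpha> \<bullet> \<alpha>)"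
        using mn by (auto intro!: mult_right_mono)
      ultimately show "\<alpha> \<bullet> \<beta> \<ge> \<beta> \<bullet> \<beta>" "\<alpha> \<bullet> \<beta> \<ge> \<alpha> \<bullet> \<alpha>" by (auto simp: inner_commute)
    qed
    then have "(\<alpha> - \<beta>) \<bullet> (\<alpha> - \<beta>) \<le> 0"
      by (simp add: inner_diff_left inner_diff_right inner_commute)
    then have "\<alpha> = \<beta>" by (metis inner_gt_zero_iff not_less right_minus_eq)
    with assms(3) show False by simp
  qed
  then consider "m = 1" | "n = 1" using pos by force
  then show ?thesis
  proof cases
    case 1
    then show ?thesis using reflect_root[OF assms(2,1)] m by (simp add: reflect_def)
  next
    case 2
    then have "\<beta> - \<alpha> \<in> \<Delta>" using reflect_root[OF assms(1,2)] n by (simp add: reflect_def)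
    then show ?thesis using minus_root by fastforce
  qed
qed

section \<open>Chambers and their interior vectors\<close>

definition regular_vector :: "'a \<Rightarrow> bool" where
  "regular_vector v \<longleftrightarrow> (\<forall>\<alpha>\<in>\<Delta>. v \<bullet> \<alpha> \<noteq> 0)"

definition pos :: "'a \<Rightarrow> 'a set" where
  "pos v = {\<alpha>\<in>\<Delta>. 0 < v \<bullet> \<alpha>}"

text \<open>A chamber is represented by a regular vector in its interior, on which reflections act
  directly. By \<open>weyl_chambers_eq\<close> these cones are exactly the chambers; different
  vectors may represent the same one.\<close>

definition cone :: "'a \<Rightarrow> 'a set" where
  "cone v = {u. \<forall>\<alpha>\<in>pos v. 0 \<le> u \<bullet> \<alpha>}"

definition simples :: "'a \<Rightarrow> 'a set" where
  "simples v = {\<alpha> \<in> pos v. \<not> (\<exists>\<beta>\<in>pos v. \<exists>\<gamma>\<in>pos v. \<alpha> = \<beta> + \<gamma>)}"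

lemma exists_regular: "\<exists>v. regular_vector v"
  using exists_avoiding_hyperplanes[OF finite_roots zero_not_root] by (auto simp: regular_vector_def)

lemma pos_root: "\<alpha> \<in> pos v \<Longrightarrow> \<alpha> \<in> \<Delta>" and finite_pos: "finite (pos v)"
  and simple_pos: "\<alpha> \<in> simples v \<Longrightarrow> \<alpha> \<in> pos v" and finite_simples: "finite (simples v)"
  using finite_roots by (auto simp: pos_def simples_def)

lemma simple_root: "\<alpha> \<in> simples v \<Longrightarrow> \<alpha> \<in> \<Delta>"
  using simple_pos pos_root by blast

lemma pos_or_minus: "regular_vector v \<Longrightarrow> \<alpha> \<in> \<Delta> \<Longrightarrow> \<alpha> \<in> pos v \<or> - \<alpha> \<in> pos v"
  by (force simp: regular_vector_def pos_def minus_root_iff not_less order_less_le)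

lemma self_in_cone: "v \<in> cone v"
  by (auto simp: cone_def pos_def)

lemma open_chamber:
  assumes v: "regular_vector v"
  shows "closure {u. \<forall>\<alpha>\<in>pos v. 0 < u \<bullet> \<alpha>} = cone v"
proof
  have "closed (cone v)"
    unfolding cone_def Collect_ball_eq
    by (intro closed_INT ballI closed_Collect_le continuous_intros)
  then show "closure {u. \<forall>\<alpha>\<in>pos v. 0 < u \<bullet> \<alpha>} \<subseteq> cone v"
    by (intro closure_minimal) (auto simp: cone_def less_imp_le)
next
  show "cone v \<subseteq> closure {u. \<forall>\<alpha>\<in>pos v. 0 < u \<bullet> \<alpha>}"
  proof
    fix u assume u: "u \<in> cone v"
    \<comment> \<open>Adding any positive multiple of \<open>v\<close> moves a point of the cone
      into the open chamber.\<close>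
    have "(\<lambda>n. u + (1 / real (Suc n)) *\<^sub>R v) \<longlonglongrightarrow> u + 0 *\<^sub>R v"
      by (intro tendsto_intros LIMSEQ_Suc[OF lim_1_over_n])
    moreover have "u + (1 / real (Suc n)) *\<^sub>R v \<in> {u. \<forall>\<alpha>\<in>pos v. 0 < u \<bullet> \<alpha>}" for n
      using u by (auto simp: cone_def pos_def inner_add_left intro!: add_nonneg_pos)
    ultimately show "u \<in> closure {u. \<forall>\<alpha>\<in>pos v. 0 < u \<bullet> \<alpha>}"
      unfolding closure_sequential by force
  qed
qed

text \<open>The open chamber is convex, hence connected. Conversely, a root cannot change sign on a
  connected set that avoids its hyperplane.\<close>

lemma component_complement:
  assumes v: "regular_vector v"
  shows "connected_component_set (- (\<Union>\<alpha>\<in>\<Delta>. {v. v \<bullet> \<alpha> = 0})) v = {u. \<forall>\<alpha>\<in>pos v. 0 < u \<bullet> \<alpha>}"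
    (is "connected_component_set ?R v = ?C")
proof
  have "convex ?C"
    unfolding Collect_ball_eq
    by (intro convex_INT) (simp add: inner_commute[of _ "_ :: 'a"] convex_halfspace_gt)
  then have "connected ?C" by (rule convex_connected)
  moreover have "?C \<subseteq> ?R"
    using pos_or_minus[OF v] by force
  moreover have "v \<in> ?C" by (auto simp: pos_def)
  ultimately show "?C \<subseteq> connected_component_set ?R v"
    by (rule connected_component_maximal[rotated])
next
  show "connected_component_set ?R v \<subseteq> ?C"
  proof safe
    fix u \<alpha> assume u: "connected_component ?R v u" and \<alpha>: "\<alpha> \<in> pos v"
    obtain T where T: "connected T" "T \<subseteq> ?R" "v \<in> T" "u \<in> T"
      using u unfolding connected_component_def by blast
    show "0 < u \<bullet> \<alpha>"
    proof (rule ccontr)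
      assume "\<not> 0 < u \<bullet> \<alpha>"
      then have "u \<bullet> \<alpha> \<le> 0" "0 \<le> v \<bullet> \<alpha>" using \<alpha> by (auto simp: pos_def)
      moreover have "connected ((\<lambda>x. x \<bullet> \<alpha>) ` T)"
        by (intro connected_continuous_image T continuous_intros)
      ultimately have "0 \<in> (\<lambda>x. x \<bullet> \<alpha>) ` T"
        using T(3,4) unfolding connected_iff_interval by blast
      then show False using T(2) pos_root[OF \<alpha>] by fastforce
    qed
  qed
qed

lemma weyl_chambers_eq: "weyl_chambers \<Delta> = cone ` {v. regular_vector v}"
proof -
  have "- (\<Union>\<alpha>\<in>\<Delta>. {v. v \<bullet> \<alpha> = 0}) = {v. regular_vector v}"
    by (auto simp: regular_vector_def)
  then show ?thesis
    unfolding weyl_chambers_def components_def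
    using component_complement open_chamber by (auto simp: image_image)
qed

lemma cone_chamber: "regular_vector v \<Longrightarrow> cone v \<in> weyl_chambers \<Delta>"
  by (auto simp: weyl_chambers_eq)

section \<open>Simple roots as a basis, and the dual basis\<close>

lemma positive_roots_cone: "regular_vector v \<Longrightarrow> positive_roots \<Delta> (cone v) = pos v"
  using self_in_cone[of v] 
  by (force simp: positive_roots_def cone_def pos_def regular_vector_def order_less_le)

lemma simple_roots_cone: "regular_vector v \<Longrightarrow> simple_roots \<Delta> (cone v) = simples v"
  by (simp add: simple_roots_def simples_def positive_roots_cone)

text \<open>A positive root that is not simple splits into two with smaller values at
  \<open>v\<close>. These values are real, so the measure is the number of positive roots with a
  smaller value.\<close>

lemma pos_induct [consumes 1, case_names simple sum]:
  assumes "\<alpha> \<in> pos v"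
    and simple: "\<And>\<alpha>. \<alpha> \<in> simples v \<Longrightarrow> P \<alpha>"
    and sum: "\<And>\<alpha> \<beta>. \<alpha> \<in> pos v \<Longrightarrow> \<beta> \<in> pos v \<Longrightarrow> P \<alpha> \<Longrightarrow> P \<beta> \<Longrightarrow> P (\<alpha> + \<beta>)"
  shows "P \<alpha>"
  using assms(1)
proof (induction "card {\<gamma>\<in>pos v. v \<bullet> \<gamma> < v \<bullet> \<alpha>}" arbitrary: \<alpha> rule: less_induct)
  case less
  show ?case
  proof (cases "\<alpha> \<in> simples v")
    case False
    then obtain \<beta> \<gamma> where bc: "\<beta> \<in> pos v" "\<gamma> \<in> pos v" "\<alpha> = \<beta> + \<gamma>"
      using less.prems by (auto simp: simples_def)
    have "P \<delta>" if "\<delta> \<in> pos v" "v \<bullet> \<delta> < v \<bullet> \<alpha>" for \<delta>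
      using that finite_pos[of v] by (intro less.hyps psubset_card_mono) auto
    moreover have "v \<bullet> \<beta> < v \<bullet> \<alpha>" "v \<bullet> \<gamma> < v \<bullet> \<alpha>" using bc by (auto simp: pos_def inner_add_right)
    ultimately show ?thesis using bc sum by auto
  qed (rule simple)
qed

text \<open>At an acute angle the difference would be a root up to sign positive, and adding it back
  would decompose one of the two simple roots.\<close>

lemma simples_obtuse:
  assumes v: "regular_vector v" and "\<alpha> \<in> simples v" "\<beta> \<in> simples v" "\<alpha> \<noteq> \<beta>"
  shows "\<alpha> \<bullet> \<beta> \<le> 0"
proof (rule ccontr)
  assume "\<not> \<alpha> \<bullet> \<beta> \<le> 0"
  then have "\<alpha> - \<beta> \<in> \<Delta>" using root_diff assms simple_root by auto
  then consider "\<alpha> - \<beta> \<in> pos v" | "\<beta> - \<alpha> \<in> pos v" using pos_or_minus[OF v] by fastforce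
  then show False
  proof cases
    case 1
    have "\<alpha> = \<beta> + (\<alpha> - \<beta>)" by simp
    then show ?thesis using 1 assms simple_pos unfolding simples_def by blast
  next
    case 2
    have "\<beta> = \<alpha> + (\<beta> - \<alpha>)" by simp
    then show ?thesis using 2 assms simple_pos unfolding simples_def by blast
  qed
qed

text \<open>Vectors in an open half-space with no acute angles between them are independent. Moving
  the negative coefficients of a relation to the other side writes one vector \<open>x\<close> in
  two ways, whence \<open>x \<bullet> x \<le> 0\<close>; pairing \<open>x = 0\<close> with
  \<open>v\<close> then kills the coefficients of both signs.\<close>

lemma simples_independent:
  assumes v: "regular_vector v"
  shows "independent (simples v)"
proof (rule independent_if_scalars_zero[OF finite_simples])
  fix f :: "'a \<Rightarrow> real" and \<alpha>
  assume zero: "(\<Sum>\<beta>\<in>simples v. f \<beta> *\<^sub>R \<beta>) = 0" and \<alpha>: "\<alpha> \<in> simples v"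
  let ?A = "{\<beta>\<in>simples v. f \<beta> > 0}" and ?B = "{\<beta>\<in>simples v. f \<beta> < 0}"
  define x where "x = (\<Sum>\<beta>\<in>?A. f \<beta> *\<^sub>R \<beta>)"
  have fin: "finite ?A" "finite ?B" using finite_simples by auto
  have "(\<Sum>\<beta>\<in>simples v. f \<beta> *\<^sub>R \<beta>) = (\<Sum>\<beta>\<in>?A \<union> ?B. f \<beta> *\<^sub>R \<beta>)"
    using finite_simples by (intro sum.mono_neutral_right) (auto simp: not_less)
  also have "\<dots> = x + (\<Sum>\<beta>\<in>?B. f \<beta> *\<^sub>R \<beta>)"
    unfolding x_def using fin by (intro sum.union_disjoint) auto
  finally have x2: "x = (\<Sum>\<beta>\<in>?B. (- f \<beta>) *\<^sub>R \<beta>)"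
    using zero by (simp add: sum_negf eq_neg_iff_add_eq_0)
  have "x \<bullet> x = (\<Sum>\<beta>\<in>?A. f \<beta> *\<^sub>R \<beta>) \<bullet> (\<Sum>\<gamma>\<in>?B. (- f \<gamma>) *\<^sub>R \<gamma>)"
    by (rule arg_cong2[of _ _ _ _ inner], rule x_def, rule x2)
  also have "\<dots> = (\<Sum>\<beta>\<in>?A. \<Sum>\<gamma>\<in>?B. (f \<beta> *\<^sub>R \<beta>) \<bullet> ((- f \<gamma>) *\<^sub>R \<gamma>))"
    by (simp only: inner_sum_left, simp only: inner_sum_right)
  also have "\<dots> = (\<Sum>\<beta>\<in>?A. \<Sum>\<gamma>\<in>?B. f \<beta> * - f \<gamma> * (\<beta> \<bullet> \<gamma>))"
    by (intro sum.cong refl) simp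
  also have "\<dots> \<le> 0"
  proof (intro sum_nonpos)
    fix \<beta> \<gamma> assume "\<beta> \<in> ?A" "\<gamma> \<in> ?B"
    then show "f \<beta> * - f \<gamma> * (\<beta> \<bullet> \<gamma>) \<le> 0"
      by (intro mult_nonneg_nonpos mult_nonneg_nonneg simples_obtuse[OF v]) auto
  qed
  finally have x0: "x = 0" by (metis inner_gt_zero_iff not_less)
  have "?A = {}"
  proof (rule ccontr)
    assume "?A \<noteq> {}"
    then have "0 < (\<Sum>\<beta>\<in>?A. f \<beta> * (v \<bullet> \<beta>))"
      using fin simple_pos by (intro sum_pos) (auto simp: pos_def)
    moreover have "v \<bullet> x = (\<Sum>\<beta>\<in>?A. f \<beta> * (v \<bullet> \<beta>))" by (simp add: x_def inner_sum_right)
    ultimately show False using x0 by simp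
  qed
  moreover have "?B = {}"
  proof (rule ccontr)
    assume "?B \<noteq> {}"
    then have "0 < (\<Sum>\<beta>\<in>?B. - f \<beta> * (v \<bullet> \<beta>))"
      using fin simple_pos by (intro sum_pos) (auto simp: pos_def mult_neg_pos)
    moreover have "v \<bullet> x = (\<Sum>\<beta>\<in>?B. - f \<beta> * (v \<bullet> \<beta>))" by (subst x2) (simp add: inner_sum_right)
    ultimately show False using x0 by simp
  qed
  ultimately show "f \<alpha> = 0" using \<alpha> by (cases "f \<alpha>" "0::real" rule: linorder_cases) auto
qed

lemma simples_span:
  assumes v: "regular_vector v"
  shows "span (simples v) = UNIV"
proof -
  have "\<alpha> \<in> span (simples v)" if "\<alpha> \<in> pos v" for \<alpha>
    using that by (induction rule: pos_induct) (auto intro: span_base span_add)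
  then have "\<alpha> \<in> span (simples v)" if "\<alpha> \<in> \<Delta>" for \<alpha>
    using pos_or_minus[OF v that] span_neg by fastforce
  then show ?thesis using span_minimal[OF _ subspace_span, of \<Delta> "simples v"] span_roots by auto
qed

text \<open>The fundamental coweight of \<alpha>: pairing with it reads off the coefficient at a
  simple root \<alpha> (\<open>simples_expand\<close>). Independence of the simple roots provides
  existence.\<close>

definition coweight :: "'a \<Rightarrow> 'a \<Rightarrow> 'a" where
  "coweight v \<alpha> = (SOME w. \<forall>\<beta>\<in>simples v. w \<bullet> \<beta> = (if \<beta> = \<alpha> then 1 else 0))"

lemma coweight_simple:
  assumes v: "regular_vector v" and "\<beta> \<in> simples v"
  shows "coweight v \<alpha> \<bullet> \<beta> = (if \<beta> = \<alpha> then 1 else 0)"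
proof -
  obtain g :: "'a \<Rightarrow> real" where g: "linear g" "\<forall>\<beta>\<in>simples v. g \<beta> = (if \<beta> = \<alpha> then 1 else 0)"
    using linear_independent_extend[OF simples_independent[OF v], of "\<lambda>\<beta>. if \<beta> = \<alpha> then 1 else 0"]
    by blast
  \<comment> \<open>\<open>adjoint g 1\<close> is the vector that represents the functional
    \<open>g\<close>.\<close>
  have "g x = adjoint g 1 \<bullet> x" for x
    using adjoint_works[OF g(1), of x 1] by (simp add: inner_commute)
  then have "\<exists>w. \<forall>\<beta>\<in>simples v. w \<bullet> \<beta> = (if \<beta> = \<alpha> then 1 else 0)" using g(2) by metis
  from someI_ex[OF this] show ?thesis using assms(2) by (simp add: coweight_def)
qed

lemma simples_expand:
  assumes v: "regular_vector v"
  shows "x = (\<Sum>\<alpha>\<in>simples v. (coweight v \<alpha> \<bullet> x) *\<^sub>R \<alpha>)"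
proof -
  have "linear (\<lambda>x. \<Sum>\<alpha>\<in>simples v. (coweight v \<alpha> \<bullet> x) *\<^sub>R \<alpha>)"
    by (intro linear_compose_sum ballI linearI) (auto simp: inner_add_right algebra_simps)
  moreover have "(\<Sum>\<alpha>\<in>simples v. (coweight v \<alpha> \<bullet> \<beta>) *\<^sub>R \<alpha>) = \<beta>" if "\<beta> \<in> simples v" for \<beta>
    using that finite_simples
    by (simp add: coweight_simple[OF v that] if_distrib[of "\<lambda>c. c *\<^sub>R _"] cong: if_cong)
  ultimately show ?thesis
    using simples_span[OF v]
    by (intro linear_eq_on_span[of "\<lambda>x. x" _ "simples v" x] linear_ident) auto
qed

lemma inner_simples_expand:
  assumes v: "regular_vector v"
  shows "x \<bullet> y = (\<Sum>\<alpha>\<in>simples v. (coweight v \<alpha> \<bullet> x) * (\<alpha> \<bullet> y))"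
  by (subst simples_expand[OF v, of x]) (simp add: inner_sum_left)

lemma coweight_pos:
  assumes v: "regular_vector v" and "\<beta> \<in> pos v"
  shows "coweight v \<alpha> \<bullet> \<beta> \<in> \<int>" "0 \<le> coweight v \<alpha> \<bullet> \<beta>"
  using assms(2) by (induction rule: pos_induct) (auto simp: coweight_simple[OF v] inner_add_right)

lemma coweight_in_cone: "regular_vector v \<Longrightarrow> coweight v \<alpha> \<in> cone v"
  by (auto simp: cone_def coweight_pos)

lemma coweight_root_lattice:
  assumes v: "regular_vector v" and "y \<in> root_lattice \<Delta>"
  shows "coweight v \<alpha> \<bullet> y \<in> \<int>"
proof -
  have "coweight v \<alpha> \<bullet> \<beta> \<in> \<int>" if "\<beta> \<in> \<Delta>" for \<beta>
    using pos_or_minus[OF v that] coweight_pos(1)[OF v, of _ \<alpha>] by fastforce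
  moreover obtain k where "y = (\<Sum>\<beta>\<in>\<Delta>. of_int (k \<beta>) *\<^sub>R \<beta>)"
    using assms(2) by (auto simp: root_lattice_def)
  ultimately show ?thesis by (simp add: inner_sum_right Ints_sum)
qed

section \<open>Lattices and the dual monoids of chambers\<close>

lemma root_lattice_add: "x \<in> root_lattice \<Delta> \<Longrightarrow> y \<in> root_lattice \<Delta> \<Longrightarrow> x + y \<in> root_lattice \<Delta>"
proof -
  assume "x \<in> root_lattice \<Delta>" "y \<in> root_lattice \<Delta>"
  then obtain k l where "x = (\<Sum>\<alpha>\<in>\<Delta>. of_int (k \<alpha>) *\<^sub>R \<alpha>)" "y = (\<Sum>\<alpha>\<in>\<Delta>. of_int (l \<alpha>) *\<^sub>R \<alpha>)"
    by (auto simp: root_lattice_def)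
  then have "x + y = (\<Sum>\<alpha>\<in>\<Delta>. of_int (k \<alpha> + l \<alpha>) *\<^sub>R \<alpha>)" by (simp add: algebra_simps sum.distrib)
  then show ?thesis unfolding root_lattice_def by (intro CollectI exI[of _ "\<lambda>\<alpha>. k \<alpha> + l \<alpha>"] conjI TrueI)
qed

lemma root_lattice_scale: "x \<in> root_lattice \<Delta> \<Longrightarrow> of_int n *\<^sub>R x \<in> root_lattice \<Delta>"
proof -
  assume "x \<in> root_lattice \<Delta>"
  then obtain k where "x = (\<Sum>\<alpha>\<in>\<Delta>. of_int (k \<alpha>) *\<^sub>R \<alpha>)"
    by (auto simp: root_lattice_def)
  then have "of_int n *\<^sub>R x = (\<Sum>\<alpha>\<in>\<Delta>. of_int (n * k \<alpha>) *\<^sub>R \<alpha>)" by (simp add: scaleR_sum_right)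
  then show ?thesis unfolding root_lattice_def by (intro CollectI exI[of _ "\<lambda>\<alpha>. n * k \<alpha>"] conjI TrueI)
qed

lemma root_lattice_minus: "x \<in> root_lattice \<Delta> \<Longrightarrow> - x \<in> root_lattice \<Delta>"
  using root_lattice_scale[of x "-1"] by simp

lemma root_lattice_diff: "x \<in> root_lattice \<Delta> \<Longrightarrow> y \<in> root_lattice \<Delta> \<Longrightarrow> x - y \<in> root_lattice \<Delta>"
  using root_lattice_add[of x "- y"] root_lattice_minus by simp

lemma zero_root_lattice: "0 \<in> root_lattice \<Delta>"
  unfolding root_lattice_def by (auto intro!: exI[of _ "\<lambda>_. 0"])

lemma root_in_root_lattice: "\<alpha> \<in> \<Delta> \<Longrightarrow> \<alpha> \<in> root_lattice \<Delta>"
  unfolding root_lattice_def using finite_roots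
  by (auto intro!: exI[of _ "\<lambda>\<beta>. if \<beta> = \<alpha> then 1 else 0"] simp: if_distrib[of "\<lambda>c. of_int c *\<^sub>R _"] cong: if_cong)

lemma weight_lattice_diff: "x \<in> weight_lattice \<Delta> \<Longrightarrow> y \<in> weight_lattice \<Delta> \<Longrightarrow> x - y \<in> weight_lattice \<Delta>"
  by (auto simp: weight_lattice_def coroot_pairing_diff)

lemma root_lattice_weight: "y \<in> root_lattice \<Delta> \<Longrightarrow> y \<in> weight_lattice \<Delta>"
proof -
  assume "y \<in> root_lattice \<Delta>"
  then obtain k where k: "y = (\<Sum>\<alpha>\<in>\<Delta>. of_int (k \<alpha>) *\<^sub>R \<alpha>)" by (auto simp: root_lattice_def)
  have "coroot_pairing y \<beta> = (\<Sum>\<alpha>\<in>\<Delta>. of_int (k \<alpha>) * coroot_pairing \<alpha> \<beta>)" for \<beta>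
    unfolding k coroot_pairing_def
    by (simp add: inner_sum_left sum_distrib_left sum_divide_distrib ac_simps)
  then show ?thesis using pairing_roots_Ints by (simp add: weight_lattice_def Ints_sum)
qed

text \<open>The coweights lie in the cone, which gives one direction. For the other,
  \<open>u \<bullet> y\<close> is a sum of products of coordinates of \<open>y\<close> with pairings
  of \<open>u\<close> with simple roots, all non-negative.\<close>

lemma dual_monoid_cone:
  assumes v: "regular_vector v"
  shows "y \<in> dual_monoid \<Delta> (cone v) \<longleftrightarrow> y \<in> root_lattice \<Delta> \<and> (\<forall>\<alpha>\<in>simples v. 0 \<le> coweight v \<alpha> \<bullet> y)"
proof (intro iffI conjI ballI)
  assume y: "y \<in> root_lattice \<Delta> \<and> (\<forall>\<alpha>\<in>simples v. 0 \<le> coweight v \<alpha> \<bullet> y)"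
  have "0 \<le> u \<bullet> y" if "u \<in> cone v" for u
    unfolding inner_commute[of u y] inner_simples_expand[OF v, of y u] using y that simple_pos[of _ v]
    by (intro sum_nonneg mult_nonneg_nonneg) (auto simp: cone_def inner_commute)
  then show "y \<in> dual_monoid \<Delta> (cone v)" using y by (auto simp: dual_monoid_def)
qed (auto simp: dual_monoid_def coweight_in_cone[OF v])

lemma dual_monoid_add: "x \<in> dual_monoid \<Delta> \<tau> \<Longrightarrow> y \<in> dual_monoid \<Delta> \<tau> \<Longrightarrow> x + y \<in> dual_monoid \<Delta> \<tau>"
  by (auto simp: dual_monoid_def root_lattice_add inner_add_right)

lemma dual_monoid_zero: "0 \<in> dual_monoid \<Delta> \<tau>"
  by (auto simp: dual_monoid_def zero_root_lattice)

lemma dual_monoid_mono: "\<sigma> \<subseteq> \<tau> \<Longrightarrow> dual_monoid \<Delta> \<tau> \<subseteq> dual_monoid \<Delta> \<sigma>"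
  by (auto simp: dual_monoid_def)

lemma dual_monoid_scale: "y \<in> dual_monoid \<Delta> \<tau> \<Longrightarrow> real n *\<^sub>R y \<in> dual_monoid \<Delta> \<tau>"
  using root_lattice_scale[of y "int n"] by (auto simp: dual_monoid_def)

lemma pos_dual_monoid: "\<alpha> \<in> pos v \<Longrightarrow> \<alpha> \<in> dual_monoid \<Delta> (cone v)"
  using pos_root root_in_root_lattice by (auto simp: dual_monoid_def cone_def)

section \<open>Reflections and adjacent chambers\<close>

lemma reflect_regular: "regular_vector v \<Longrightarrow> \<alpha> \<in> \<Delta> \<Longrightarrow> regular_vector (reflect \<alpha> v)"
  by (auto simp: regular_vector_def reflect_inner_swap reflect_root)

lemma pos_reflect: "\<alpha> \<in> \<Delta> \<Longrightarrow> pos (reflect \<alpha> v) = reflect \<alpha> ` pos v"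
proof -
  assume \<alpha>: "\<alpha> \<in> \<Delta>"
  have "x \<in> reflect \<alpha> ` A \<longleftrightarrow> reflect \<alpha> x \<in> A" for x A by (force simp: image_iff)
  moreover have "reflect \<alpha> \<beta> \<in> \<Delta> \<longleftrightarrow> \<beta> \<in> \<Delta>" for \<beta>
    using reflect_root[OF \<alpha>] reflect_reflect by metis
  ultimately show ?thesis by (auto simp: set_eq_iff pos_def reflect_inner_swap)
qed

lemma cone_reflect: "\<alpha> \<in> \<Delta> \<Longrightarrow> u \<in> cone (reflect \<alpha> v) \<longleftrightarrow> reflect \<alpha> u \<in> cone v"
  by (auto simp: cone_def pos_reflect reflect_inner_swap)

lemma simples_reflect: "\<alpha> \<in> \<Delta> \<Longrightarrow> simples (reflect \<alpha> v) = reflect \<alpha> ` simples v"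
proof -
  assume \<alpha>: "\<alpha> \<in> \<Delta>"
  have *: "x = reflect \<alpha> y \<longleftrightarrow> reflect \<alpha> x = y" for x y by auto
  have "x \<in> reflect \<alpha> ` A \<longleftrightarrow> reflect \<alpha> x \<in> A" for x A by (force simp: image_iff)
  then show ?thesis
    by (auto simp: set_eq_iff simples_def pos_reflect[OF \<alpha>] reflect_add[symmetric] *)
qed

text \<open>Reflection in \<alpha> changes only the coordinate at \<alpha>. A negative image would
  force all other coordinates of \<beta> to vanish, so \<beta> would be a multiple of \<alpha>, and
  the root system is reduced.\<close>

lemma reflect_simple_pos:
  assumes v: "regular_vector v" and \<alpha>: "\<alpha> \<in> simples v" and \<beta>: "\<beta> \<in> pos v" "\<beta> \<noteq> \<alpha>"
  shows "reflect \<alpha> \<beta> \<in> pos v"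
proof (rule ccontr)
  assume "reflect \<alpha> \<beta> \<notin> pos v"
  then have neg: "- reflect \<alpha> \<beta> \<in> pos v"
    using pos_or_minus[OF v] reflect_root simple_root[OF \<alpha>] pos_root[OF \<beta>(1)] by blast
  have "coweight v \<gamma> \<bullet> \<beta> = 0" if "\<gamma> \<in> simples v" "\<gamma> \<noteq> \<alpha>" for \<gamma>
  proof -
    have "coweight v \<gamma> \<bullet> \<alpha> = 0" using coweight_simple[OF v \<alpha>] that by auto
    then have "coweight v \<gamma> \<bullet> reflect \<alpha> \<beta> = coweight v \<gamma> \<bullet> \<beta>"
      by (simp add: reflect_def inner_diff_right)
    then show ?thesis using coweight_pos(2)[OF v neg, of \<gamma>] coweight_pos(2)[OF v \<beta>(1), of \<gamma>] by simp
  qed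
  then have "(\<Sum>\<gamma>\<in>simples v. (coweight v \<gamma> \<bullet> \<beta>) *\<^sub>R \<gamma>) = (coweight v \<alpha> \<bullet> \<beta>) *\<^sub>R \<alpha>"
    using \<alpha> finite_simples by (subst sum.remove[of _ \<alpha>]) auto
  then have eq: "\<beta> = (coweight v \<alpha> \<bullet> \<beta>) *\<^sub>R \<alpha>" using trans[OF simples_expand[OF v, of \<beta>]] by blast
  define c where "c = coweight v \<alpha> \<bullet> \<beta>"
  have c: "\<beta> = c *\<^sub>R \<alpha>" "0 \<le> c"
    using eq coweight_pos(2)[OF v \<beta>(1), of \<alpha>] unfolding c_def by blast+
  then have "c = 1 \<or> c = - 1"
    using proportional_roots[OF simple_root[OF \<alpha>], of c] pos_root[OF \<beta>(1)] by blast
  then show False using c \<beta>(2) by auto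
qed

text \<open>These coweights are orthogonal to \<alpha>, so the reflection fixes them: they lie on
  the common wall of the two chambers.\<close>

lemma coweight_in_adjacent_cone:
  assumes v: "regular_vector v" and \<alpha>: "\<alpha> \<in> simples v" and "\<gamma> \<noteq> \<alpha>"
  shows "coweight v \<gamma> \<in> cone (reflect \<alpha> v)"
  using coweight_in_cone[OF v, of \<gamma>] coweight_simple[OF v \<alpha>, of \<gamma>] assms(3)
  by (simp add: cone_reflect[OF simple_root[OF \<alpha>]] reflect_orthogonal)

text \<open>Perturb \<open>x\<close> by a small positive multiple of a regular vector. Roots not
  orthogonal to \<open>x\<close> keep their sign, and on the others the perturbation
  decides.\<close>

lemma exists_dominating:
  obtains v where "regular_vector v" "\<And>\<alpha>. \<alpha> \<in> pos v \<Longrightarrow> 0 \<le> x \<bullet> \<alpha>"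
proof -
  obtain u where u: "regular_vector u" using exists_regular by blast
  have "\<forall>\<^sub>F e in at_right (0::real). (x + e *\<^sub>R u) \<bullet> \<alpha> \<noteq> 0 \<and> (0 < (x + e *\<^sub>R u) \<bullet> \<alpha> \<longrightarrow> 0 \<le> x \<bullet> \<alpha>)" if "\<alpha> \<in> \<Delta>" for \<alpha>
  proof -
    have lim: "((\<lambda>e::real. (x + e *\<^sub>R u) \<bullet> \<alpha>) \<longlongrightarrow> (x + 0 *\<^sub>R u) \<bullet> \<alpha>) (at_right 0)"
      by (intro tendsto_intros)
    consider "x \<bullet> \<alpha> > 0" | "x \<bullet> \<alpha> < 0" | "x \<bullet> \<alpha> = 0" by linarith
    then show ?thesis
    proof cases
      case 1
      then have "\<forall>\<^sub>F e in at_right (0::real). 0 < (x + e *\<^sub>R u) \<bullet> \<alpha>" using order_tendstoD(1)[OF lim, of 0] by simp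
      then show ?thesis by (rule eventually_mono) (use 1 in auto)
    next
      case 2
      then have "\<forall>\<^sub>F e in at_right (0::real). (x + e *\<^sub>R u) \<bullet> \<alpha> < 0" using order_tendstoD(2)[OF lim, of 0] by simp
      then show ?thesis by (rule eventually_mono) auto
    next
      case 3
      have "\<forall>\<^sub>F e in at_right (0::real). 0 < e" by (simp add: eventually_at_right_less)
      then show ?thesis
        by eventually_elim (use 3 u that in \<open>auto simp: inner_add_left regular_vector_def\<close>)
    qed
  qed
  then have "\<forall>\<^sub>F e in at_right (0::real). \<forall>\<alpha>\<in>\<Delta>. (x + e *\<^sub>R u) \<bullet> \<alpha> \<noteq> 0 \<and> (0 < (x + e *\<^sub>R u) \<bullet> \<alpha> \<longrightarrow> 0 \<le> x \<bullet> \<alpha>)"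
    by (simp add: eventually_ball_finite[OF finite_roots])
  then obtain e where "\<forall>\<alpha>\<in>\<Delta>. (x + e *\<^sub>R u) \<bullet> \<alpha> \<noteq> 0 \<and> (0 < (x + e *\<^sub>R u) \<bullet> \<alpha> \<longrightarrow> 0 \<le> x \<bullet> \<alpha>)"
    using eventually_happens trivial_limit_at_right_real by blast
  then show ?thesis by (intro that[of "x + e *\<^sub>R u"]) (auto simp: regular_vector_def pos_def)
qed

end

section \<open>Lattice points of special polytopes\<close>

text \<open>For an ample polytope \<open>P\<close> this is \<Lambda>(P), with \<open>P\<close> cut
  out by its tangent cones at the vertices. In this form it is an intersection over the charts of
  the weights of local sections.\<close>

definition lattice_points :: "'a::euclidean_space set \<Rightarrow> ('a set \<Rightarrow> 'a) \<Rightarrow> 'a set" where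
  "lattice_points \<Delta> \<mu> = {x. \<forall>\<sigma>\<in>weyl_chambers \<Delta>. \<mu> \<sigma> - x \<in> dual_monoid \<Delta> \<sigma>}"

section \<open>Heights and acute simple roots\<close>

context reduced_root_system
begin

text \<open>Measure of the inductions on roots and on the excess of a sum, and later the grading
  that contracts a chart to its fixed point.\<close>

definition height :: "'a \<Rightarrow> 'a \<Rightarrow> real" where
  "height v x = (\<Sum>\<alpha>\<in>simples v. coweight v \<alpha> \<bullet> x)"

lemma height_add: "height v (x + y) = height v x + height v y"
  and height_diff: "height v (x - y) = height v x - height v y"
  by (simp_all add: height_def inner_add_right inner_diff_right sum.distrib sum_subtractf)

lemma height_scaleR: "height v (c *\<^sub>R x) = c * height v x"
  by (simp add: height_def sum_distrib_left)

lemma height_simple: "regular_vector v \<Longrightarrow> \<alpha> \<in> simples v \<Longrightarrow> height v \<alpha> = 1"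
  using finite_simples by (simp add: height_def coweight_simple)

lemma height_Ints: "regular_vector v \<Longrightarrow> y \<in> root_lattice \<Delta> \<Longrightarrow> height v y \<in> \<int>"
  by (simp add: height_def coweight_root_lattice Ints_sum)

lemma height_nonneg: "regular_vector v \<Longrightarrow> y \<in> dual_monoid \<Delta> (cone v) \<Longrightarrow> 0 \<le> height v y"
  by (simp add: height_def dual_monoid_cone sum_nonneg)

lemma nat_height_less:
  assumes "height u x < height v y" "0 \<le> height u x" "height v y \<in> \<int>"
  shows "nat \<lfloor>height u x\<rfloor> < nat \<lfloor>height v y\<rfloor>"
  using assms by (auto elim!: Ints_cases) linarith

lemma height_zero:
  assumes v: "regular_vector v" and y: "y \<in> dual_monoid \<Delta> (cone v)" and "height v y = 0"
  shows "y = 0"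
proof -
  have "coweight v \<alpha> \<bullet> y = 0" if "\<alpha> \<in> simples v" for \<alpha>
    using assms(3) y that finite_simples
    by (simp add: height_def dual_monoid_cone[OF v] sum_nonneg_eq_0_iff)
  then show ?thesis using simples_expand[OF v, of y] by simp
qed

lemma coweight_reflect:
  assumes v: "regular_vector v" and \<alpha>: "\<alpha> \<in> \<Delta>" and \<gamma>: "\<gamma> \<in> simples v"
  shows "coweight (reflect \<alpha> v) (reflect \<alpha> \<gamma>) = reflect \<alpha> (coweight v \<gamma>)"
proof -
  let ?w = "reflect \<alpha> v"
  note w = reflect_regular[OF v \<alpha>]
  have eq: "coweight ?w (reflect \<alpha> \<gamma>) \<bullet> \<beta> = reflect \<alpha> (coweight v \<gamma>) \<bullet> \<beta>"
    if \<beta>: "\<beta> \<in> simples ?w" for \<beta>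
  proof -
    obtain \<delta> where \<delta>: "\<beta> = reflect \<alpha> \<delta>" "\<delta> \<in> simples v" using \<beta> by (auto simp: simples_reflect[OF \<alpha>])
    have "reflect \<alpha> \<delta> = reflect \<alpha> \<gamma> \<longleftrightarrow> \<delta> = \<gamma>" using reflect_reflect by metis
    then show ?thesis
      using coweight_simple[OF w \<beta>] coweight_simple[OF v \<delta>(2)] by (simp add: \<delta>(1) reflect_inner_swap)
  qed
  have "coweight ?w (reflect \<alpha> \<gamma>) \<bullet> x = reflect \<alpha> (coweight v \<gamma>) \<bullet> x" for x
  proof (rule linear_eq_on_span[where f = "inner (coweight ?w (reflect \<alpha> \<gamma>))" and g = "inner (reflect \<alpha> (coweight v \<gamma>))"])
    show "x \<in> span (simples ?w)" using simples_span[OF w] by simp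
  qed (simp_all add: eq bounded_linear.linear bounded_linear_inner_right)
  then show ?thesis by (metis inner_eq_zero_iff inner_diff_left right_minus_eq)
qed

text \<open>Coordinates at the reflected chamber are those of \<open>reflect \<alpha> x\<close> at
  \<open>v\<close>, and \<alpha> has height 1. Hence the height of a root drops on crossing the wall
  of a simple root acute to it.\<close>

lemma height_reflect:
  assumes v: "regular_vector v" and \<alpha>: "\<alpha> \<in> simples v"
  shows "height (reflect \<alpha> v) x = height v x - coroot_pairing x \<alpha>"
proof -
  note r = simple_root[OF \<alpha>]
  have inj: "inj_on (reflect \<alpha>) (simples v)" by (rule inj_on_inverseI[of _ "reflect \<alpha>"]) simp
  have "height (reflect \<alpha> v) x = (\<Sum>\<gamma>\<in>simples v. coweight v \<gamma> \<bullet> reflect \<alpha> x)"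
    unfolding height_def simples_reflect[OF r] sum.reindex[OF inj]
    by (intro sum.cong) (simp_all add: coweight_reflect[OF v r] reflect_inner_swap)
  also have "\<dots> = height v x - coroot_pairing x \<alpha>"
    using height_simple[OF v \<alpha>] by (simp add: height_def[symmetric] reflect_def height_diff height_scaleR)
  finally show ?thesis .
qed

lemma pos_reflect_simple:
  assumes v: "regular_vector v" and \<alpha>: "\<alpha> \<in> simples v" and "\<beta> \<in> pos v" "\<beta> \<noteq> \<alpha>"
  shows "\<beta> \<in> pos (reflect \<alpha> v)"
  using reflect_simple_pos[OF assms] reflect_reflect[of \<alpha> \<beta>]
  unfolding pos_reflect[OF simple_root[OF \<alpha>]] by (metis image_eqI)

text \<open>Expanding one factor of \<open>x \<bullet> x > 0\<close> in simple roots yields a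
  positive summand.\<close>

lemma exists_simple_acute:
  assumes v: "regular_vector v" and "\<And>\<gamma>. \<gamma> \<in> simples v \<Longrightarrow> 0 \<le> coweight v \<gamma> \<bullet> x" and "x \<noteq> 0"
  obtains \<alpha> where "\<alpha> \<in> simples v" "0 < \<alpha> \<bullet> x" "0 < coweight v \<alpha> \<bullet> x"
proof -
  have "0 < x \<bullet> x" using assms(3) by simp
  then have "0 < (\<Sum>\<alpha>\<in>simples v. (coweight v \<alpha> \<bullet> x) * (\<alpha> \<bullet> x))"
    using inner_simples_expand[OF v, of x x] by simp
  then obtain \<alpha> where \<alpha>: "\<alpha> \<in> simples v" "0 < (coweight v \<alpha> \<bullet> x) * (\<alpha> \<bullet> x)"
    using sum_nonpos[of "simples v"] by (meson not_less)
  then show ?thesis using that[of \<alpha>] assms(2)[of \<alpha>] by (auto simp: zero_less_mult_iff)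
qed

lemma weight_pairing_ge_1:
  assumes "x \<in> weight_lattice \<Delta>" "\<beta> \<in> \<Delta>" "0 < x \<bullet> \<beta>"
  shows "1 \<le> coroot_pairing x \<beta>"
proof -
  have "coroot_pairing x \<beta> \<in> \<int>" using assms by (auto simp: weight_lattice_def)
  moreover have "0 < coroot_pairing x \<beta>" using coroot_pairing_pos_iff[OF root_nonzero] assms by simp
  ultimately show ?thesis by (auto elim!: Ints_cases)
qed

lemma weight_lattice_minus: "x \<in> weight_lattice \<Delta> \<Longrightarrow> - x \<in> weight_lattice \<Delta>"
  using weight_lattice_diff[of 0 x] by (auto simp: weight_lattice_def coroot_pairing_def)

lemma cone_reflect_neq:
  assumes \<alpha>: "\<alpha> \<in> pos v"
  shows "cone v \<noteq> cone (reflect \<alpha> v)"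
proof
  assume "cone v = cone (reflect \<alpha> v)"
  then have "reflect \<alpha> v \<in> cone v" using self_in_cone[of v] cone_reflect[OF pos_root[OF \<alpha>]] by blast
  then have "reflect \<alpha> v \<bullet> \<alpha> \<ge> 0" using \<alpha> by (simp add: cone_def)
  then show False using \<alpha> reflect_inner_self[OF root_nonzero[OF pos_root[OF \<alpha>]], of v] by (simp add: pos_def)
qed

text \<open>Ampleness yields information on a vertex by comparison with another chamber, so a second
  one must exist. The ambient space has positive dimension, hence there is a simple root to reflect
  in.\<close>

lemma exists_adjacent_chamber:
  assumes "\<sigma> \<in> weyl_chambers \<Delta>"
  obtains \<tau> where "\<tau> \<in> weyl_chambers \<Delta>" "\<sigma> \<noteq> \<tau>"
proof -
  obtain v where v: "regular_vector v" "\<sigma> = cone v" using assms by (auto simp: weyl_chambers_eq)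
  have "simples v \<noteq> {}"
  proof
    assume "simples v = {}"
    then have "UNIV = {0 :: 'a}" using simples_span[OF v(1)] by simp
    then have "(SOME b. b \<in> Basis) = (0 :: 'a)" by blast
    then show False using nonzero_Basis[OF SOME_Basis] by blast
  qed
  then obtain \<alpha> where "\<alpha> \<in> simples v" by blast
  then have "\<alpha> \<in> pos v" by (rule simple_pos)
  then show ?thesis
    using that[OF cone_chamber[OF reflect_regular[OF v(1) pos_root]]] cone_reflect_neq v(2) by simp
qed

end

text \<open>The last two assumptions are the form in which ampleness arrives;
  \<open>vertex_adjacent\<close> recovers from them the positive edge lengths of an ample
  polytope.\<close>

locale special_polytope = reduced_root_system \<Delta> for \<Delta> :: "'a::euclidean_space set" +
  fixes \<mu> :: "'a set \<Rightarrow> 'a"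
  assumes vertex_weight: "\<sigma> \<in> weyl_chambers \<Delta> \<Longrightarrow> \<mu> \<sigma> \<in> weight_lattice \<Delta>"
    and vertex_dominant: "\<sigma> \<in> weyl_chambers \<Delta> \<Longrightarrow> dominant \<Delta> \<sigma> (\<mu> \<sigma>)"
    and vertex_lattice_point: "\<sigma> \<in> weyl_chambers \<Delta> \<Longrightarrow> \<mu> \<sigma> \<in> lattice_points \<Delta> \<mu>"
    and vertex_inj: "\<sigma> \<in> weyl_chambers \<Delta> \<Longrightarrow> \<tau> \<in> weyl_chambers \<Delta> \<Longrightarrow> \<sigma> \<noteq> \<tau> \<Longrightarrow> \<mu> \<sigma> \<noteq> \<mu> \<tau>"
begin

lemma vertex_dual:
  assumes "regular_vector u" "regular_vector v"
  shows "\<mu> (cone v) - \<mu> (cone u) \<in> dual_monoid \<Delta> (cone v)"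
  using vertex_lattice_point[OF cone_chamber[OF assms(1)]] cone_chamber[OF assms(2)]
  by (simp add: lattice_points_def)

lemma vertex_inner_nonneg:
  assumes v: "regular_vector v" and "\<beta> \<in> pos v"
  shows "0 \<le> \<mu> (cone v) \<bullet> \<beta>"
  using assms(2)
proof (induction rule: pos_induct)
  case (simple \<alpha>)
  then show ?case
    using vertex_dominant[OF cone_chamber[OF v]] coroot_pairing_nonneg_iff[OF root_nonzero[OF simple_root[OF simple]]]
    by (auto simp: dominant_def simple_roots_cone[OF v])
qed (simp add: inner_add_right)

text \<open>Coweights of the other simple roots lie in both cones, so they pair both non-negatively
  and non-positively with the difference. Only the coordinate at \<alpha> is left, and it is not
  zero because the vertices differ.\<close>

lemma vertex_adjacent:
  assumes v: "regular_vector v" and \<alpha>: "\<alpha> \<in> simples v"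
  obtains r where "0 < r" "\<mu> (cone v) - \<mu> (cone (reflect \<alpha> v)) = r *\<^sub>R \<alpha>"
proof -
  note w = reflect_regular[OF v simple_root[OF \<alpha>]]
  let ?d = "\<mu> (cone v) - \<mu> (cone (reflect \<alpha> v))"
  have d: "?d \<in> dual_monoid \<Delta> (cone v)" "- ?d \<in> dual_monoid \<Delta> (cone (reflect \<alpha> v))"
    using vertex_dual[OF v w] vertex_dual[OF w v] by simp_all
  have "coweight v \<gamma> \<bullet> ?d = 0" if "\<gamma> \<in> simples v" "\<gamma> \<noteq> \<alpha>" for \<gamma>
    using d coweight_in_cone[OF v, of \<gamma>] coweight_in_adjacent_cone[OF v \<alpha> that(2)]
    unfolding dual_monoid_def by (force simp only: inner_minus_right mem_Collect_eq)
  then have "(\<Sum>\<gamma>\<in>simples v. (coweight v \<gamma> \<bullet> ?d) *\<^sub>R \<gamma>) = (coweight v \<alpha> \<bullet> ?d) *\<^sub>R \<alpha>"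
    using \<alpha> finite_simples by (subst sum.remove[of _ \<alpha>]) (auto intro!: sum.neutral)
  then have eq: "?d = (coweight v \<alpha> \<bullet> ?d) *\<^sub>R \<alpha>" using trans[OF simples_expand[OF v, of ?d]] by blast
  have "cone v \<noteq> cone (reflect \<alpha> v)" by (rule cone_reflect_neq[OF simple_pos[OF \<alpha>]])
  then have "?d \<noteq> 0" using vertex_inj[OF cone_chamber[OF v] cone_chamber[OF w]] by simp
  moreover have "0 \<le> coweight v \<alpha> \<bullet> ?d" using d(1) \<alpha> by (simp only: dual_monoid_cone[OF v])
  ultimately have "0 < coweight v \<alpha> \<bullet> ?d" using eq by (metis less_eq_real_def scale_zero_left)
  then show ?thesis using eq that by blast
qed

lemma lattice_point_weight:
  assumes "y \<in> lattice_points \<Delta> \<mu>"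
  shows "y \<in> weight_lattice \<Delta>"
proof -
  obtain v where "regular_vector v" using exists_regular by blast
  note \<sigma> = cone_chamber[OF this]
  have "\<mu> (cone v) - y \<in> root_lattice \<Delta>" using assms \<sigma> by (auto simp: lattice_points_def dual_monoid_def)
  then show ?thesis
    using weight_lattice_diff[OF vertex_weight[OF \<sigma>] root_lattice_weight] by fastforce
qed

text \<open>
  Induction on the height of \<open>\<beta>\<close>. If \<open>\<beta>\<close> is not simple, reflect in a simple root \<open>\<alpha>\<close> with \<open>0 < \<alpha> \<bullet> \<beta>\<close>: the
  height of \<open>\<beta>\<close> drops and only the coordinate at \<open>\<alpha>\<close> is lost. Dominance of \<open>\<mu>\<close> at the adjacent chamber,
  where \<open>\<beta>\<close> is still positive, forces \<open>\<mu>\<close> at \<open>cone v\<close> to pair strictly positively with \<open>\<beta>\<close>, so that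
  \<open>0 \<le> (\<mu> (cone v) - y - \<beta>) \<bullet> \<beta>\<close>, and this controls the missing coordinate.
\<close>

lemma lattice_point_plus_negative_root:
  assumes y: "y \<in> lattice_points \<Delta> \<mu>"
    and v: "regular_vector v" and \<beta>: "\<beta> \<in> pos v" and neg: "y \<bullet> \<beta> < 0"
  shows "\<mu> (cone v) - y - \<beta> \<in> dual_monoid \<Delta> (cone v)"
  using v \<beta>
proof (induction "nat \<lfloor>height v \<beta>\<rfloor>" arbitrary: v rule: less_induct)
  case less
  note v = less.prems(1) and \<beta> = less.prems(2)
  note root = pos_root[OF \<beta>]
  let ?d = "\<mu> (cone v) - y - \<beta>"
  have dual: "\<mu> (cone u) - y \<in> dual_monoid \<Delta> (cone u)" if "regular_vector u" for u
    using y cone_chamber[OF that] by (auto simp: lattice_points_def)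
  then have Y: "?d \<in> root_lattice \<Delta>"
    using v root_lattice_diff root_in_root_lattice[OF root] by (auto simp: dual_monoid_def)
  have coord: "0 \<le> coweight v \<gamma> \<bullet> (\<mu> (cone v) - y)" if "\<gamma> \<in> simples v" for \<gamma>
    using dual[OF v] that by (simp only: dual_monoid_cone[OF v])
  have "0 \<le> coweight v \<gamma> \<bullet> ?d" if \<gamma>: "\<gamma> \<in> simples v" for \<gamma>
  proof (cases "\<beta> \<in> simples v")
    case True
    show ?thesis
    proof (cases "\<gamma> = \<beta>")
      case False
      then show ?thesis using coord[OF \<gamma>] coweight_simple[OF v True, of \<gamma>] by (simp add: inner_diff_right)
    next
      case eq: True
      let ?c = "coweight v \<beta> \<bullet> (\<mu> (cone v) - y)"
      \<comment> \<open>If this coordinate vanished, the obtuse angles between simple roots would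
        make \<open>\<mu> (cone v) - y\<close> pair non-positively with \<beta>, contrary to
        dominance and \<open>neg\<close>.\<close>
      have "?c \<noteq> 0"
      proof
        assume c: "?c = 0"
        have "(\<mu> (cone v) - y) \<bullet> \<beta> \<le> 0"
        proof (subst inner_simples_expand[OF v], intro sum_nonpos)
          fix \<delta> assume \<delta>: "\<delta> \<in> simples v"
          show "coweight v \<delta> \<bullet> (\<mu> (cone v) - y) * (\<delta> \<bullet> \<beta>) \<le> 0"
            using c coord[OF \<delta>] simples_obtuse[OF v \<delta> True]
            by (cases "\<delta> = \<beta>") (auto intro: mult_nonneg_nonpos)
        qed
        then show False using neg vertex_inner_nonneg[OF v \<beta>] by (simp add: inner_diff_left)
      qed
      moreover have "?c \<in> \<int>" using coweight_root_lattice[OF v] dual[OF v] by (auto simp: dual_monoid_def)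
      ultimately have "1 \<le> ?c" using coord[OF True] by (auto elim!: Ints_cases)
      then show ?thesis using coweight_simple[OF v True, of \<beta>] by (simp add: eq inner_diff_right)
    qed
  next
    case False
    have other: "0 \<le> coweight v \<delta> \<bullet> ?d"
      if \<alpha>: "\<alpha> \<in> simples v" "0 < \<alpha> \<bullet> \<beta>" and \<delta>: "\<delta> \<in> simples v" "\<delta> \<noteq> \<alpha>" for \<alpha> \<delta>
    proof -
      let ?w = "reflect \<alpha> v"
      note w = reflect_regular[OF v simple_root[OF \<alpha>(1)]]
      have \<beta>w: "\<beta> \<in> pos ?w" using pos_reflect_simple[OF v \<alpha>(1) \<beta>] False \<alpha>(1) by blast
      have "height ?w \<beta> < height v \<beta>"
        using height_reflect[OF v \<alpha>(1)] coroot_pairing_pos_iff[OF root_nonzero[OF simple_root[OF \<alpha>(1)]], of \<beta>] \<alpha>(2)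
        by (simp add: inner_commute)
      then have "\<mu> (cone ?w) - y - \<beta> \<in> dual_monoid \<Delta> (cone ?w)"
        by (intro less.hyps nat_height_less height_nonneg height_Ints w v \<beta>w pos_dual_monoid
            root_in_root_lattice root)
      then have "0 \<le> coweight v \<delta> \<bullet> (\<mu> (cone ?w) - y - \<beta>)"
        using coweight_in_adjacent_cone[OF v \<alpha>(1) \<delta>(2)] by (auto simp: dual_monoid_def)
      \<comment> \<open>Returning to \<open>v\<close> changes the vertex by a multiple of \<alpha>,
        which the other coweights do not see.\<close>
      moreover obtain r where r: "\<mu> (cone v) - \<mu> (cone ?w) = r *\<^sub>R \<alpha>"
        using vertex_adjacent[OF v \<alpha>(1)] by blast
      have "coweight v \<delta> \<bullet> (\<mu> (cone v) - \<mu> (cone ?w)) = 0"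
        unfolding r using coweight_simple[OF v \<alpha>(1), of \<delta>] \<delta>(2) by auto
      ultimately show ?thesis by (simp add: inner_diff_right)
    qed
    obtain \<alpha> where \<alpha>: "\<alpha> \<in> simples v" "0 < \<alpha> \<bullet> \<beta>"
      using exists_simple_acute[OF v coweight_pos(2)[OF v \<beta>] root_nonzero[OF root]] by blast
    have "0 \<le> ?d \<bullet> \<beta>"
    proof -
      obtain r where r: "0 < r" "\<mu> (cone v) - \<mu> (cone (reflect \<alpha> v)) = r *\<^sub>R \<alpha>"
        using vertex_adjacent[OF v \<alpha>(1)] by blast
      have "0 \<le> \<mu> (cone (reflect \<alpha> v)) \<bullet> \<beta>"
        using vertex_inner_nonneg[OF reflect_regular[OF v simple_root[OF \<alpha>(1)]]]
          pos_reflect_simple[OF v \<alpha>(1) \<beta>] False \<alpha>(1) by blast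
      moreover have "(\<mu> (cone v) - \<mu> (cone (reflect \<alpha> v))) \<bullet> \<beta> = r * (\<alpha> \<bullet> \<beta>)" unfolding r(2) by simp
      ultimately have "0 < \<mu> (cone v) \<bullet> \<beta>" using \<alpha>(2) r(1) by (simp add: inner_diff_left) (smt (verit) mult_pos_pos)
      \<comment> \<open>Pairings of weights are integral, so the positive ones of the vertex and of
        \<open>- y\<close> are at least 1 each. Together they pay for the 2 that \<beta> takes
        away.\<close>
      then have "1 \<le> coroot_pairing (\<mu> (cone v)) \<beta>"
        using weight_pairing_ge_1[OF vertex_weight[OF cone_chamber[OF v]] root] by simp
      moreover have "1 \<le> coroot_pairing (- y) \<beta>"
        using weight_pairing_ge_1[OF weight_lattice_minus[OF lattice_point_weight[OF y]] root] neg by simp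
      ultimately have "0 \<le> coroot_pairing ?d \<beta>"
        using coroot_pairing_self[OF root_nonzero[OF root]] coroot_pairing_diff[of 0 y \<beta>]
        by (simp add: coroot_pairing_diff) (simp add: coroot_pairing_def)
      then show ?thesis using coroot_pairing_nonneg_iff[OF root_nonzero[OF root]] by simp
    qed
    show ?thesis
    proof (rule ccontr)
      assume nn: "\<not> 0 \<le> coweight v \<gamma> \<bullet> ?d"
      \<comment> \<open>By \<open>other\<close>, each acute simple root secures every coordinate but
        its own. A negative one at \<gamma> thus makes \<gamma> the only simple root acute to
        \<beta>; then no term of the expansion of \<open>?d \<bullet> \<beta>\<close> is positive
        and the one at \<gamma> is negative.\<close>
      have eq: "\<alpha>' = \<gamma>" if "\<alpha>' \<in> simples v" "0 < \<alpha>' \<bullet> \<beta>" for \<alpha>'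
        using other[OF that \<gamma>] nn by blast
      then have \<gamma>\<beta>: "0 < \<gamma> \<bullet> \<beta>" using \<alpha> by blast
      have "?d \<bullet> \<beta> = (\<Sum>\<delta>\<in>simples v. (coweight v \<delta> \<bullet> ?d) * (\<delta> \<bullet> \<beta>))" by (rule inner_simples_expand[OF v])
      also have "\<dots> = (coweight v \<gamma> \<bullet> ?d) * (\<gamma> \<bullet> \<beta>) + (\<Sum>\<delta>\<in>simples v - {\<gamma>}. (coweight v \<delta> \<bullet> ?d) * (\<delta> \<bullet> \<beta>))"
        using \<gamma> finite_simples by (rule sum.remove[rotated])
      also have "(\<Sum>\<delta>\<in>simples v - {\<gamma>}. (coweight v \<delta> \<bullet> ?d) * (\<delta> \<bullet> \<beta>)) \<le> 0"
        using other[OF \<gamma> \<gamma>\<beta>] eq by (intro sum_nonpos mult_nonneg_nonpos) (auto simp: not_less[symmetric])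
      finally have "?d \<bullet> \<beta> \<le> (coweight v \<gamma> \<bullet> ?d) * (\<gamma> \<bullet> \<beta>)" by simp
      moreover have "(coweight v \<gamma> \<bullet> ?d) * (\<gamma> \<bullet> \<beta>) < 0" using nn \<gamma>\<beta> by (intro mult_neg_pos) auto
      ultimately show False using \<open>0 \<le> ?d \<bullet> \<beta>\<close> by linarith
    qed
  qed
  then show ?case unfolding dual_monoid_cone[OF v] using Y by blast
qed

text \<open>Each chamber has \<alpha> or \<open>- \<alpha>\<close> among its positive roots. In the
  first case the difference from the vertex only grows; the second is the preceding lemma for
  \<open>- \<alpha>\<close>.\<close>

lemma lattice_point_minus_root:
  assumes y: "y \<in> lattice_points \<Delta> \<mu>" and \<alpha>: "\<alpha> \<in> \<Delta>" and "0 < y \<bullet> \<alpha>"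
  shows "y - \<alpha> \<in> lattice_points \<Delta> \<mu>"
  unfolding lattice_points_def weyl_chambers_eq
proof safe
  fix v assume v: "regular_vector v"
  show "\<mu> (cone v) - (y - \<alpha>) \<in> dual_monoid \<Delta> (cone v)"
  proof (cases "\<alpha> \<in> pos v")
    case True
    have "\<mu> (cone v) - y \<in> dual_monoid \<Delta> (cone v)"
      using y cone_chamber[OF v] by (auto simp: lattice_points_def)
    from dual_monoid_add[OF this pos_dual_monoid[OF True]] show ?thesis by (simp add: algebra_simps)
  next
    case False
    then have "- \<alpha> \<in> pos v" using pos_or_minus[OF v \<alpha>] by blast
    from lattice_point_plus_negative_root[OF y v this] show ?thesis using assms(3) by (simp add: algebra_simps)
  qed
qed

text \<open>The invariant on the sum concerns \<open>v\<close> alone; the other chambers enter only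
  through the membership of the single summands.\<close>

lemma lattice_point_descent:
  assumes v: "regular_vector v" and dom: "\<And>\<alpha>. \<alpha> \<in> pos v \<Longrightarrow> 0 \<le> x \<bullet> \<alpha>"
    and "set ys \<subseteq> lattice_points \<Delta> \<mu>" and "sum_list ys - x \<in> dual_monoid \<Delta> (cone v)"
  shows "\<exists>zs. length zs = length ys \<and> set zs \<subseteq> lattice_points \<Delta> \<mu> \<and> sum_list zs = x"
  using assms(3,4)
proof (induction "nat \<lfloor>height v (sum_list ys - x)\<rfloor>" arbitrary: ys rule: less_induct)
  case less
  let ?d = "sum_list ys - x"
  show ?case
  proof (cases "?d = 0")
    case False
    have coord: "0 \<le> coweight v \<gamma> \<bullet> ?d" if "\<gamma> \<in> simples v" for \<gamma>
      using less.prems(2) that unfolding dual_monoid_cone[OF v] by blast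
    have Y: "?d \<in> root_lattice \<Delta>" using less.prems(2) by (auto simp: dual_monoid_def)
    obtain \<alpha> where \<alpha>: "\<alpha> \<in> simples v" "0 < \<alpha> \<bullet> ?d" "0 < coweight v \<alpha> \<bullet> ?d"
      using exists_simple_acute[OF v coord False] by blast
    have "0 < sum_list ys \<bullet> \<alpha>"
      using \<alpha>(2) dom[OF simple_pos[OF \<alpha>(1)]] by (simp add: inner_diff_right inner_commute)
    moreover have "sum_list ys \<bullet> \<alpha> \<le> 0" if "\<forall>y\<in>set ys. y \<bullet> \<alpha> \<le> 0"
      using that by (induction ys) (auto simp: inner_add_left)
    ultimately obtain y where y: "y \<in> set ys" "0 < y \<bullet> \<alpha>" by (meson not_less)
    obtain us ws where ys: "ys = us @ y # ws" using split_list[OF y(1)] by blast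
    define zs where "zs = us @ (y - \<alpha>) # ws"
    have sum: "sum_list zs - x = ?d - \<alpha>" by (simp add: ys zs_def algebra_simps)
    have "y - \<alpha> \<in> lattice_points \<Delta> \<mu>"
      using lattice_point_minus_root less.prems(1) y simple_root[OF \<alpha>(1)] by blast
    then have "set zs \<subseteq> lattice_points \<Delta> \<mu>" using less.prems(1) by (auto simp: ys zs_def)
    moreover have "0 \<le> coweight v \<gamma> \<bullet> (?d - \<alpha>)" if \<gamma>: "\<gamma> \<in> simples v" for \<gamma>
    proof (cases "\<gamma> = \<alpha>")
      case True
      have "coweight v \<alpha> \<bullet> ?d \<in> \<int>" using coweight_root_lattice[OF v Y] .
      \<comment> \<open>Integrality leaves room to subtract a whole \<alpha> without making its
        coordinate negative.\<close>
      then have "1 \<le> coweight v \<alpha> \<bullet> ?d" using \<alpha>(3) by (auto elim!: Ints_cases simp del: inner_diff_right)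
      then show ?thesis
        using coweight_simple[OF v \<alpha>(1), of \<alpha>] unfolding True inner_diff_right[of _ ?d \<alpha>] by simp
    next
      case False
      then show ?thesis
        using coord[OF \<gamma>] coweight_simple[OF v \<alpha>(1), of \<gamma>] unfolding inner_diff_right[of _ ?d \<alpha>] by simp
    qed
    then have dual: "sum_list zs - x \<in> dual_monoid \<Delta> (cone v)"
      unfolding sum dual_monoid_cone[OF v]
      using root_lattice_diff[OF Y root_in_root_lattice[OF simple_root[OF \<alpha>(1)]]] by blast
    moreover have "height v (sum_list zs - x) < height v ?d"
      unfolding sum height_diff[of v ?d \<alpha>] using height_simple[OF v \<alpha>(1)] by simp
    then have "nat \<lfloor>height v (sum_list zs - x)\<rfloor> < nat \<lfloor>height v ?d\<rfloor>"
      by (intro nat_height_less height_nonneg[OF v dual] height_Ints[OF v Y])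
    ultimately have "\<exists>us. length us = length zs \<and> set us \<subseteq> lattice_points \<Delta> \<mu> \<and> sum_list us = x"
      by (intro less.hyps)
    then show ?thesis by (simp add: ys zs_def)
  qed (use less.prems in auto)
qed

lemma lattice_points_sum:
  assumes "x \<in> lattice_points \<Delta> (\<lambda>\<sigma>. real m *\<^sub>R \<mu> \<sigma>)"
  obtains ys where "length ys = m" "set ys \<subseteq> lattice_points \<Delta> \<mu>" "sum_list ys = x"
proof -
  obtain v where v: "regular_vector v" "\<And>\<alpha>. \<alpha> \<in> pos v \<Longrightarrow> 0 \<le> x \<bullet> \<alpha>" using exists_dominating by blast
  note \<sigma> = cone_chamber[OF v(1)]
  have "sum_list (replicate m (\<mu> (cone v))) = real m *\<^sub>R \<mu> (cone v)"
    by (induction m) (auto simp: algebra_simps)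
  then have "sum_list (replicate m (\<mu> (cone v))) - x \<in> dual_monoid \<Delta> (cone v)"
    using assms \<sigma> by (auto simp: lattice_points_def)
  moreover have "set (replicate m (\<mu> (cone v))) \<subseteq> lattice_points \<Delta> \<mu>"
    using vertex_lattice_point[OF \<sigma>] by auto
  ultimately show ?thesis using lattice_point_descent[OF v] that by fastforce
qed

end

section \<open>Monomial sections\<close>

text \<open>Along the multiples of a vector \<open>w\<close> with distinct pairings on
  \<open>A\<close>, the exponentials are powers of distinct numbers \<open>z x\<close>. The relation
  therefore holds with any polynomial evaluated at the \<open>z x\<close>, and one that vanishes at
  all of them but \<open>z y\<close> isolates \<open>c y\<close>.\<close>

lemma exp_independent:
  fixes A :: "'a::euclidean_space set" and c :: "'a \<Rightarrow> complex"
  assumes "finite A" and zero: "\<And>v. (\<Sum>y\<in>A. c y * of_real (exp (v \<bullet> y))) = 0" and "y \<in> A"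
  shows "c y = 0"
proof -
  let ?D = "(\<lambda>(a, b). a - b) ` (A \<times> A) - {0}"
  have "finite ?D" "0 \<notin> ?D" using assms(1) by auto
  then obtain w where w: "\<forall>d\<in>?D. w \<bullet> d \<noteq> 0" using exists_avoiding_hyperplanes by blast
  define z :: "'a \<Rightarrow> complex" where "z = (\<lambda>x. of_real (exp (w \<bullet> x)))"
  have inj: "z a \<noteq> z b" if ab: "a \<in> A" "b \<in> A" "a \<noteq> b" for a b
  proof -
    have "a - b \<in> ?D" using ab by (auto intro!: image_eqI[of _ _ "(a, b)"])
    then have "w \<bullet> (a - b) \<noteq> 0" using w by blast
    then show ?thesis by (simp add: z_def inner_diff_right)
  qed
  have pow: "(\<Sum>x\<in>A. c x * z x ^ n) = 0" for n
    using zero[of "real n *\<^sub>R w"] by (simp add: z_def exp_of_nat_mult flip: of_real_power)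
  have "(\<Sum>x\<in>A. c x * poly p (z x)) = 0" for p
  proof -
    have "(\<Sum>x\<in>A. c x * poly p (z x)) = (\<Sum>n\<le>degree p. coeff p n * (\<Sum>x\<in>A. c x * z x ^ n))"
      unfolding poly_altdef sum_distrib_left by (subst sum.swap) (simp add: mult.left_commute)
    then show ?thesis by (simp add: pow)
  qed
  from this[of "\<Prod>x\<in>A - {y}. [:- z x, 1:]"]
  have "(\<Sum>x\<in>A. c x * (\<Prod>b\<in>A - {y}. z x - z b)) = 0" by (simp add: poly_prod)
  moreover have "(\<Sum>x\<in>A. c x * (\<Prod>b\<in>A - {y}. z x - z b)) = c y * (\<Prod>b\<in>A - {y}. z y - z b)"
    using assms(1,3) by (subst sum.remove[of A y]) (auto intro!: sum.neutral)
  moreover have "(\<Prod>b\<in>A - {y}. z y - z b) \<noteq> 0"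
    using assms(1,3) inj by auto
  ultimately show ?thesis by simp
qed

lemma exp_sums_unique:
  fixes A B :: "'a::euclidean_space set" and a b :: "'a \<Rightarrow> complex"
  assumes fin: "finite A" "finite B" and nz: "\<And>y. y \<in> A \<Longrightarrow> a y \<noteq> 0" "\<And>y. y \<in> B \<Longrightarrow> b y \<noteq> 0"
    and eq: "\<And>v. (\<Sum>y\<in>A. a y * of_real (exp (v \<bullet> y))) = (\<Sum>y\<in>B. b y * of_real (exp (v \<bullet> y)))"
  shows "A = B" "\<And>y. y \<in> A \<Longrightarrow> a y = b y"
proof -
  define c where "c = (\<lambda>y. (if y \<in> A then a y else 0) - (if y \<in> B then b y else 0))"
  have "(\<Sum>y\<in>A \<union> B. c y * of_real (exp (v \<bullet> y))) = 0" for v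
  proof -
    have "(\<Sum>y\<in>A \<union> B. c y * of_real (exp (v \<bullet> y))) =
      (\<Sum>y\<in>A \<union> B. if y \<in> A then a y * of_real (exp (v \<bullet> y)) else 0)
      - (\<Sum>y\<in>A \<union> B. if y \<in> B then b y * of_real (exp (v \<bullet> y)) else 0)"
      unfolding sum_subtractf[symmetric] by (intro sum.cong) (auto simp: c_def algebra_simps)
    also have "\<dots> = (\<Sum>y\<in>A. a y * of_real (exp (v \<bullet> y))) - (\<Sum>y\<in>B. b y * of_real (exp (v \<bullet> y)))"
      using fin by (simp add: sum.inter_restrict[symmetric] Int_absorb1)
    finally show ?thesis using eq by simp
  qed
  from exp_independent[OF _ this] have c: "c y = 0" if "y \<in> A \<union> B" for y using that fin by blast
  show "A = B" using c nz by (force simp: c_def split: if_splits)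
  then show "a y = b y" if "y \<in> A" for y using c[of y] that by (simp add: c_def)
qed

text \<open>A real positive point of the big torus, seen in a chart when \<open>M\<close> is a dual
  monoid and in \<open>T\<close> when \<open>M\<close> is the weight lattice. These points suffice
  to recover the coefficients of a regular function.\<close>

definition exp_point :: "'a::euclidean_space set \<Rightarrow> 'a \<Rightarrow> 'a \<Rightarrow> complex" where
  "exp_point M v = (\<lambda>y. if y \<in> M then of_real (exp (v \<bullet> y)) else 0)"

text \<open>Normal form of an equivariant line bundle. The constant cocycle \<open>c\<close> could
  be removed by rescaling the trivialisations; it is carried along so that \<open>L\<close> stays as
  given.\<close>

definition monomial_bundle ::
  "'a::euclidean_space set \<Rightarrow> 'a torus_bundle \<Rightarrow> ('a set \<Rightarrow> 'a set \<Rightarrow> complex) \<Rightarrow> ('a set \<Rightarrow> 'a) \<Rightarrow> bool" where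
  "monomial_bundle \<Delta> L c \<mu> \<longleftrightarrow>
     (\<forall>\<sigma>\<in>weyl_chambers \<Delta>. \<forall>\<tau>\<in>weyl_chambers \<Delta>.
        \<mu> \<sigma> - \<mu> \<tau> \<in> dual_monoid \<Delta> (\<sigma> \<inter> \<tau>) \<and>
        (\<forall>q\<in>chart \<Delta> (\<sigma> \<inter> \<tau>). trans L \<sigma> \<tau> q = c \<sigma> \<tau> * q (\<mu> \<sigma> - \<mu> \<tau>))) \<and>
     (\<forall>\<sigma>\<in>weyl_chambers \<Delta>. c \<sigma> \<sigma> = 1) \<and>
     (\<forall>\<sigma>\<in>weyl_chambers \<Delta>. \<forall>\<tau>\<in>weyl_chambers \<Delta>. \<forall>\<rho>\<in>weyl_chambers \<Delta>. c \<sigma> \<tau> * c \<tau> \<rho> = c \<sigma> \<rho>)"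

text \<open>The section of weight \<open>x\<close>. The constants are taken relative to a base
  chamber \<sigma>0, as \<open>\<lambda>\<sigma>. c \<sigma> \<sigma>0\<close>, to match the
  transition functions.\<close>

definition monomial_section ::
  "'a::euclidean_space set \<Rightarrow> ('a set \<Rightarrow> complex) \<Rightarrow> ('a set \<Rightarrow> 'a) \<Rightarrow> 'a \<Rightarrow> 'a bundle_section" where
  "monomial_section \<Delta> c \<mu> x =
     (\<lambda>\<sigma> p. if \<sigma> \<in> weyl_chambers \<Delta> \<and> p \<in> chart \<Delta> \<sigma> then c \<sigma> * p (\<mu> \<sigma> - x) else 0)"

text \<open>Zero coefficients are dropped so that \<open>exp_sums_unique\<close> determines the
  support.\<close>

lemma regular_expansion:
  assumes "f \<in> regular \<Delta> \<tau>"
  obtains A c where "finite A" "A \<subseteq> dual_monoid \<Delta> \<tau>" "\<And>y. y \<in> A \<Longrightarrow> c y \<noteq> 0"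
    "\<And>p. p \<in> chart \<Delta> \<tau> \<Longrightarrow> f p = (\<Sum>y\<in>A. c y * p y)"
proof -
  obtain A c where A: "finite A" "A \<subseteq> dual_monoid \<Delta> \<tau>" "\<And>p. p \<in> chart \<Delta> \<tau> \<Longrightarrow> f p = (\<Sum>y\<in>A. c y * p y)"
    using assms by (auto simp: regular_def)
  have "f p = (\<Sum>y\<in>{y\<in>A. c y \<noteq> 0}. c y * p y)" if "p \<in> chart \<Delta> \<tau>" for p
    unfolding A(3)[OF that] using A(1) by (intro sum.mono_neutral_right) auto
  with A show ?thesis by (intro that[of "{y\<in>A. c y \<noteq> 0}" c]) auto
qed

lemma chart_zero: "p \<in> chart \<Delta> \<tau> \<Longrightarrow> p 0 = 1"
  and chart_add: "p \<in> chart \<Delta> \<tau> \<Longrightarrow> x \<in> dual_monoid \<Delta> \<tau> \<Longrightarrow> y \<in> dual_monoid \<Delta> \<tau> \<Longrightarrow> p (x + y) = p x * p y"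
  and chart_outside: "p \<in> chart \<Delta> \<tau> \<Longrightarrow> y \<notin> dual_monoid \<Delta> \<tau> \<Longrightarrow> p y = 0"
  by (auto simp: chart_def)

section \<open>Points of charts and the monomial form of a bundle\<close>

context reduced_root_system
begin

lemma weight_lattice_add: "x \<in> weight_lattice \<Delta> \<Longrightarrow> y \<in> weight_lattice \<Delta> \<Longrightarrow> x + y \<in> weight_lattice \<Delta>"
  using weight_lattice_diff[of x "- y"] weight_lattice_minus by simp

lemma dual_monoid_weight: "y \<in> dual_monoid \<Delta> \<tau> \<Longrightarrow> y \<in> weight_lattice \<Delta>"
  using root_lattice_weight by (auto simp: dual_monoid_def)

lemma zero_weight: "0 \<in> weight_lattice \<Delta>"
  by (rule root_lattice_weight[OF zero_root_lattice])

lemma exp_point_chart: "exp_point (dual_monoid \<Delta> \<tau>) v \<in> chart \<Delta> \<tau>"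
  by (auto simp: exp_point_def chart_def dual_monoid_zero dual_monoid_add inner_add_right exp_add)

lemma exp_point_torus: "exp_point (weight_lattice \<Delta>) v \<in> torus \<Delta>"
  by (auto simp: exp_point_def torus_def zero_weight weight_lattice_add inner_add_right exp_add)

lemma translate_exp_point:
  "translate (exp_point (weight_lattice \<Delta>) v) (exp_point (dual_monoid \<Delta> \<tau>) u) = exp_point (dual_monoid \<Delta> \<tau>) (v + u)"
  by (auto simp: exp_point_def translate_def dual_monoid_weight inner_add_left exp_add)

lemma chart_map_exp_point:
  "\<tau> \<subseteq> \<sigma> \<Longrightarrow> chart_map \<Delta> \<sigma> (exp_point (dual_monoid \<Delta> \<tau>) v) = exp_point (dual_monoid \<Delta> \<sigma>) v"
  using dual_monoid_mono[of \<tau> \<sigma>] by (auto simp: exp_point_def chart_map_def fun_eq_iff)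

lemma chart_power: "p \<in> chart \<Delta> \<tau> \<Longrightarrow> y \<in> dual_monoid \<Delta> \<tau> \<Longrightarrow> p (real n *\<^sub>R y) = p y ^ n"
proof (induction n)
  case (Suc n)
  then show ?case using chart_add[OF Suc.prems dual_monoid_scale[OF Suc.prems(2), of n]]
    by (simp add: algebra_simps)
qed (simp add: chart_zero)

lemma chart_map_chart: "\<tau> \<subseteq> \<sigma> \<Longrightarrow> q \<in> chart \<Delta> \<tau> \<Longrightarrow> chart_map \<Delta> \<sigma> q \<in> chart \<Delta> \<sigma>"
  using dual_monoid_mono[of \<tau> \<sigma>] 
  by (auto simp: chart_def chart_map_def dual_monoid_add dual_monoid_zero subset_iff)

text \<open>Heights are non-negative on the dual monoid and vanish only at 0, so a sum is 0 only if
  both terms are. This makes the indicator of 0 multiplicative.\<close>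

lemma fixed_point_chart:
  assumes v: "regular_vector v"
  shows "fixed_point \<in> chart \<Delta> (cone v)"
proof -
  have zero: "x = 0 \<and> y = 0" if "x \<in> dual_monoid \<Delta> (cone v)" "y \<in> dual_monoid \<Delta> (cone v)" "x + y = 0" for x y
  proof -
    have "height v x + height v y = 0" using height_add[of v x y] that(3) by (simp add: height_def)
    then have "height v x = 0" "height v y = 0"
      using height_nonneg[OF v that(1)] height_nonneg[OF v that(2)] by linarith+
    then show ?thesis using height_zero[OF v] that by blast
  qed
  have add: "fixed_point (x + y) = fixed_point x * fixed_point y"
    if "x \<in> dual_monoid \<Delta> (cone v)" "y \<in> dual_monoid \<Delta> (cone v)" for x y
  proof (cases "x + y = 0")
    case True
    then show ?thesis using zero[OF that True] by (simp add: fixed_point_def)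
  next
    case False
    then show ?thesis by (auto simp: fixed_point_def)
  qed
  have "fixed_point y = 0" if "y \<notin> dual_monoid \<Delta> (cone v)" for y
    using that dual_monoid_zero by (auto simp: fixed_point_def)
  then show ?thesis
    unfolding chart_def by (intro CollectI conjI ballI allI impI add) (simp_all add: fixed_point_def)
qed

text \<open>The cocycle rule for \<open>t\<close> and its inverse \<open>t'\<close> exhibits an
  inverse of the value.\<close>

lemma act_nonzero:
  assumes L: "equivariant_line_bundle \<Delta> L" and \<sigma>: "\<sigma> \<in> weyl_chambers \<Delta>"
    and t: "t \<in> torus \<Delta>" and p: "p \<in> chart \<Delta> \<sigma>"
  shows "act L \<sigma> t p \<noteq> 0"
proof -
  define t' where "t' = (\<lambda>x. if x \<in> weight_lattice \<Delta> then inverse (t x) else 0)"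
  have "t x * t (- x) = 1" if "x \<in> weight_lattice \<Delta>" for x
  proof -
    have "t (x + - x) = t x * t (- x)" using t that weight_lattice_minus by (force simp: torus_def)
    then show ?thesis using t by (simp add: torus_def)
  qed
  then have nz: "t x \<noteq> 0" if "x \<in> weight_lattice \<Delta>" for x using that by force
  have t': "t' \<in> torus \<Delta>"
    using t by (auto simp: torus_def t'_def zero_weight weight_lattice_add)
  have "translate t' t = torus_one \<Delta>" by (auto simp: translate_def t'_def torus_one_def nz)
  moreover have "act L \<sigma> (translate t' t) p = act L \<sigma> t' (translate t p) * act L \<sigma> t p"
    "act L \<sigma> (torus_one \<Delta>) p = 1"
    using L \<sigma> t t' p by (auto simp: equivariant_line_bundle_def)
  ultimately show ?thesis by auto
qed

text \<open>
  Scaling by \<open>s ^ height\<close> contracts the chart to its fixed point as \<open>s\<close> goes to \<open>0\<close>, and the factor \<open>act\<close>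
  becomes a polynomial in \<open>s\<close> without zeros.
\<close>

lemma act_eq_fixed_point:
  assumes L: "equivariant_line_bundle \<Delta> L" and v: "regular_vector v"
    and t: "t \<in> torus \<Delta>" and p: "p \<in> chart \<Delta> (cone v)"
  shows "act L (cone v) t p = act L (cone v) t fixed_point"
proof -
  let ?M = "dual_monoid \<Delta> (cone v)"
  define h where "h = (\<lambda>y. nat \<lfloor>height v y\<rfloor>)"
  have h: "real (h y) = height v y" if "y \<in> ?M" for y
    using height_Ints[OF v, of y] height_nonneg[OF v that] that
    by (auto simp: h_def dual_monoid_def elim!: Ints_cases)
  have h_add: "h (x + y) = h x + h y" if "x \<in> ?M" "y \<in> ?M" for x y
    using h[OF that(1)] h[OF that(2)] h[OF dual_monoid_add[OF that]] height_add[of v x y] by linarith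
  \<comment> \<open>Additivity of \<open>h\<close> makes this a point of the chart for every complex
    \<open>s\<close>; at \<open>s = 0\<close> the convention \<open>0 ^ 0 = 1\<close> keeps the
    value 1 at \<open>y = 0\<close>.\<close>
  define scale where "scale = (\<lambda>(s::complex) y. if y \<in> ?M then s ^ h y * p y else 0)"
  have h0: "h 0 = 0" by (simp add: h_def height_def)
  have scale_chart: "scale s \<in> chart \<Delta> (cone v)" for s
    using p by (auto simp: chart_def scale_def h0 h_add dual_monoid_zero dual_monoid_add power_add)
  have scale_1: "scale 1 = p" using p by (auto simp: scale_def chart_def)
  have scale_0: "scale 0 = fixed_point"
  proof
    fix y
    consider "y \<notin> ?M" | "y = 0" | "y \<in> ?M" "y \<noteq> 0" by blast
    then show "scale 0 y = fixed_point y"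
    proof cases
      case 1
      then show ?thesis using dual_monoid_zero by (auto simp: scale_def fixed_point_def)
    next
      case 2
      then show ?thesis by (simp add: scale_def fixed_point_def h0 chart_zero[OF p] dual_monoid_zero)
    next
      case 3
      then have "h y \<noteq> 0" using h[of y] height_zero[OF v, of y] by force
      then show ?thesis using 3 by (simp add: scale_def fixed_point_def)
    qed
  qed
  obtain A c where A: "finite A" "A \<subseteq> weight_lattice \<Delta> \<times> ?M"
    "\<And>p. p \<in> chart \<Delta> (cone v) \<Longrightarrow> act L (cone v) t p = (\<Sum>(x, y)\<in>A. c (x, y) * t x * p y)"
  proof -
    have "act L (cone v) \<in> regular_on_torus_times \<Delta> (cone v)"
      using L cone_chamber[OF v] by (simp add: equivariant_line_bundle_def)
    then show ?thesis using t that by (auto simp: regular_on_torus_times_def)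
  qed
  define q where "q = (\<Sum>(x, y)\<in>A. monom (c (x, y) * t x * p y) (h y))"
  have q: "poly q s = act L (cone v) t (scale s)" for s
  proof -
    have "act L (cone v) t (scale s) = (\<Sum>(x, y)\<in>A. c (x, y) * t x * (s ^ h y * p y))"
      unfolding A(3)[OF scale_chart] using A(2) by (intro sum.cong refl) (auto simp: scale_def)
    then show ?thesis by (simp add: q_def poly_sum poly_monom case_prod_unfold mult_ac)
  qed
  have "poly q s \<noteq> 0" for s
    unfolding q by (rule act_nonzero[OF L cone_chamber[OF v] t scale_chart])
  then have "constant (poly q)" using fundamental_theorem_of_algebra by blast
  then have "poly q 1 = poly q 0" by (auto simp: constant_def)
  then show ?thesis by (simp add: q scale_1 scale_0)
qed

text \<open>Translating the unit point of an overlap by the torus gives the transition function at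
  all exponential points, as \<open>act\<close> is a character there. Uniqueness of exponential sums
  then leaves a single monomial in its regular expansion and places its exponent in the dual
  monoid.\<close>

lemma equivariant_monomial_bundle:
  assumes L: "equivariant_line_bundle \<Delta> L" and \<mu>: "polytope_vertices \<Delta> L \<mu>"
  obtains c where "monomial_bundle \<Delta> L c \<mu>"
proof
  \<comment> \<open>The point with \<open>v = 0\<close> takes the value 1 on the whole monoid, so
    the monomial factor disappears there.\<close>
  define c where "c = (\<lambda>\<sigma> \<tau>. trans L \<sigma> \<tau> (exp_point (dual_monoid \<Delta> (\<sigma> \<inter> \<tau>)) 0))"
  have LB: "line_bundle \<Delta> L" using L by (simp add: equivariant_line_bundle_def)
  have c1: "c \<sigma> \<sigma> = 1" if "\<sigma> \<in> weyl_chambers \<Delta>" for \<sigma>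
    using LB that exp_point_chart[of \<sigma> 0] by (simp add: c_def line_bundle_def)
  have cocycle: "c \<sigma> \<tau> * c \<tau> \<rho> = c \<sigma> \<rho>"
    if "\<sigma> \<in> weyl_chambers \<Delta>" "\<tau> \<in> weyl_chambers \<Delta>" "\<rho> \<in> weyl_chambers \<Delta>" for \<sigma> \<tau> \<rho>
  proof -
    let ?p = "exp_point (dual_monoid \<Delta> (\<sigma> \<inter> \<tau> \<inter> \<rho>)) 0"
    have maps: "chart_map \<Delta> (\<sigma> \<inter> \<tau>) ?p = exp_point (dual_monoid \<Delta> (\<sigma> \<inter> \<tau>)) 0"
      "chart_map \<Delta> (\<tau> \<inter> \<rho>) ?p = exp_point (dual_monoid \<Delta> (\<tau> \<inter> \<rho>)) 0"
      "chart_map \<Delta> (\<sigma> \<inter> \<rho>) ?p = exp_point (dual_monoid \<Delta> (\<sigma> \<inter> \<rho>)) 0"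
      by (rule chart_map_exp_point, blast)+
    have "trans L \<sigma> \<tau> (chart_map \<Delta> (\<sigma> \<inter> \<tau>) ?p) * trans L \<tau> \<rho> (chart_map \<Delta> (\<tau> \<inter> \<rho>) ?p)
          = trans L \<sigma> \<rho> (chart_map \<Delta> (\<sigma> \<inter> \<rho>) ?p)"
      using LB that exp_point_chart[of "\<sigma> \<inter> \<tau> \<inter> \<rho>" 0] unfolding line_bundle_def by blast
    then show ?thesis unfolding maps c_def .
  qed
  have act: "act L \<sigma> (exp_point (weight_lattice \<Delta>) v) p = of_real (exp (v \<bullet> \<mu> \<sigma>))"
    if \<sigma>: "\<sigma> \<in> weyl_chambers \<Delta>" and p: "p \<in> chart \<Delta> \<sigma>" for \<sigma> p v
  proof -
    obtain w where w: "regular_vector w" "\<sigma> = cone w" using \<sigma> by (auto simp: weyl_chambers_eq)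
    show ?thesis
      using act_eq_fixed_point[OF L w(1) exp_point_torus p[unfolded w(2)], of v] \<mu> \<sigma> exp_point_torus[of v]
      by (simp add: polytope_vertices_def exp_point_def w(2))
  qed
  have mono: "\<mu> \<sigma> - \<mu> \<tau> \<in> dual_monoid \<Delta> (\<sigma> \<inter> \<tau>) \<and>
        (\<forall>q\<in>chart \<Delta> (\<sigma> \<inter> \<tau>). trans L \<sigma> \<tau> q = c \<sigma> \<tau> * q (\<mu> \<sigma> - \<mu> \<tau>))"
    if \<sigma>: "\<sigma> \<in> weyl_chambers \<Delta>" and \<tau>: "\<tau> \<in> weyl_chambers \<Delta>" for \<sigma> \<tau>
  proof -
    let ?M = "dual_monoid \<Delta> (\<sigma> \<inter> \<tau>)" and ?\<delta> = "\<mu> \<sigma> - \<mu> \<tau>"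
    have trans_exp: "trans L \<sigma> \<tau> (exp_point ?M v) = c \<sigma> \<tau> * of_real (exp (v \<bullet> ?\<delta>))" for v
    proof -
      let ?t = "exp_point (weight_lattice \<Delta>) v" and ?q = "exp_point ?M 0"
      have "act L \<sigma> ?t (chart_map \<Delta> \<sigma> ?q) * trans L \<sigma> \<tau> ?q
          = trans L \<sigma> \<tau> (translate ?t ?q) * act L \<tau> ?t (chart_map \<Delta> \<tau> ?q)"
        using L \<sigma> \<tau> exp_point_torus[of v] exp_point_chart[of "\<sigma> \<inter> \<tau>" 0]
        by (simp add: equivariant_line_bundle_def)
      then have "of_real (exp (v \<bullet> \<mu> \<sigma>)) * c \<sigma> \<tau> = trans L \<sigma> \<tau> (exp_point ?M v) * of_real (exp (v \<bullet> \<mu> \<tau>))"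
        using act[OF \<sigma> exp_point_chart, of v 0] act[OF \<tau> exp_point_chart, of v 0]
        by (simp add: chart_map_exp_point translate_exp_point c_def)
      then show ?thesis by (simp add: inner_diff_right exp_diff field_simps)
    qed
    \<comment> \<open>Comparing supports requires the coefficient of the one-term sum to be
      nonzero.\<close>
    have c0: "c \<sigma> \<tau> \<noteq> 0" using cocycle[OF \<sigma> \<tau> \<sigma>] c1[OF \<sigma>] by auto
    have "trans L \<sigma> \<tau> \<in> regular \<Delta> (\<sigma> \<inter> \<tau>)" using LB \<sigma> \<tau> by (simp add: line_bundle_def)
    then obtain A d where A: "finite A" "A \<subseteq> ?M" "\<And>y. y \<in> A \<Longrightarrow> d y \<noteq> 0"
      "\<And>p. p \<in> chart \<Delta> (\<sigma> \<inter> \<tau>) \<Longrightarrow> trans L \<sigma> \<tau> p = (\<Sum>y\<in>A. d y * p y)"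
      by (rule regular_expansion) (rule that)
    have "(\<Sum>y\<in>A. d y * of_real (exp (v \<bullet> y))) = (\<Sum>y\<in>{?\<delta>}. c \<sigma> \<tau> * of_real (exp (v \<bullet> y)))" for v
    proof -
      have "(\<Sum>y\<in>A. d y * of_real (exp (v \<bullet> y))) = (\<Sum>y\<in>A. d y * exp_point ?M v y)"
        using A(2) by (intro sum.cong) (auto simp: exp_point_def)
      then show ?thesis using A(4)[OF exp_point_chart] trans_exp[of v] by simp
    qed
    from exp_sums_unique[OF A(1) _ A(3) _ this] have "A = {?\<delta>}" "\<And>y. y \<in> A \<Longrightarrow> d y = c \<sigma> \<tau>"
      using c0 by auto
    then show ?thesis using A(2,4) by auto
  qed
  show "monomial_bundle \<Delta> L c \<mu>" unfolding monomial_bundle_def using mono c1 cocycle by blast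
qed

lemma monomial_bundle_power:
  assumes "monomial_bundle \<Delta> L c \<mu>"
  shows "monomial_bundle \<Delta> (bundle_power L k) (\<lambda>\<sigma> \<tau>. c \<sigma> \<tau> ^ k) (\<lambda>\<sigma>. real k *\<^sub>R \<mu> \<sigma>)"
proof -
  have "trans (bundle_power L k) \<sigma> \<tau> q = c \<sigma> \<tau> ^ k * q (real k *\<^sub>R (\<mu> \<sigma> - \<mu> \<tau>))"
    if "\<sigma> \<in> weyl_chambers \<Delta>" "\<tau> \<in> weyl_chambers \<Delta>" "q \<in> chart \<Delta> (\<sigma> \<inter> \<tau>)" for \<sigma> \<tau> q
  proof -
    have "\<mu> \<sigma> - \<mu> \<tau> \<in> dual_monoid \<Delta> (\<sigma> \<inter> \<tau>)" "trans L \<sigma> \<tau> q = c \<sigma> \<tau> * q (\<mu> \<sigma> - \<mu> \<tau>)"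
      using assms that by (auto simp: monomial_bundle_def)
    then show ?thesis using chart_power[OF that(3)] by (simp add: bundle_power_def power_mult_distrib)
  qed
  then show ?thesis
    using assms dual_monoid_scale[of _ _ k]
    by (simp add: monomial_bundle_def scaleR_diff_right[symmetric] flip: power_mult_distrib)
qed

section \<open>Global sections of a monomial bundle\<close>

lemma regularI:
  assumes "finite I" and y: "\<And>i. i \<in> I \<Longrightarrow> y i \<in> dual_monoid \<Delta> \<tau>"
    and f: "\<And>p. p \<in> chart \<Delta> \<tau> \<Longrightarrow> f p = (\<Sum>i\<in>I. c i * p (y i))"
  shows "f \<in> regular \<Delta> \<tau>"
proof -
  have "f p = (\<Sum>z\<in>y ` I. (\<Sum>i\<in>{i\<in>I. y i = z}. c i) * p z)" if "p \<in> chart \<Delta> \<tau>" for p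
    unfolding f[OF that] sum.image_gen[OF assms(1), of _ y] sum_distrib_right
    by (intro sum.cong refl) auto
  then show ?thesis unfolding regular_def using assms(1) y
    by (intro CollectI exI[of _ "y ` I"] exI[of _ "\<lambda>z. \<Sum>i\<in>{i\<in>I. y i = z}. c i"]) auto
qed

text \<open>The lattice point condition in each chamber makes the local monomial regular, and the
  cocycle rule for \<open>c\<close> makes the local pieces agree on overlaps.\<close>

lemma monomial_section_global:
  assumes B: "monomial_bundle \<Delta> L c \<mu>" and \<sigma>: "\<sigma>0 \<in> weyl_chambers \<Delta>" and x: "x \<in> lattice_points \<Delta> \<mu>"
  shows "monomial_section \<Delta> (\<lambda>\<sigma>. c \<sigma> \<sigma>0) \<mu> x \<in> global_sections \<Delta> L"
proof -
  have mem: "\<mu> \<sigma> - x \<in> dual_monoid \<Delta> \<sigma>" if "\<sigma> \<in> weyl_chambers \<Delta>" for \<sigma>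
    using x that by (simp add: lattice_points_def)
  have "monomial_section \<Delta> (\<lambda>\<sigma>. c \<sigma> \<sigma>0) \<mu> x \<sigma> \<in> regular \<Delta> \<sigma>" if "\<sigma> \<in> weyl_chambers \<Delta>" for \<sigma>
    using mem[OF that] that
    by (intro regularI[of "{()}" "\<lambda>_. \<mu> \<sigma> - x" _ _ "\<lambda>_. c \<sigma> \<sigma>0"]) (auto simp: monomial_section_def)
  moreover have "monomial_section \<Delta> (\<lambda>\<sigma>. c \<sigma> \<sigma>0) \<mu> x \<sigma> (chart_map \<Delta> \<sigma> q)
      = trans L \<sigma> \<tau> q * monomial_section \<Delta> (\<lambda>\<sigma>. c \<sigma> \<sigma>0) \<mu> x \<tau> (chart_map \<Delta> \<tau> q)"
    if \<sigma>\<tau>: "\<sigma> \<in> weyl_chambers \<Delta>" "\<tau> \<in> weyl_chambers \<Delta>" and q: "q \<in> chart \<Delta> (\<sigma> \<inter> \<tau>)" for \<sigma> \<tau> q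
  proof -
    have "chart_map \<Delta> \<sigma> q \<in> chart \<Delta> \<sigma>" "chart_map \<Delta> \<tau> q \<in> chart \<Delta> \<tau>"
      using chart_map_chart[OF _ q] by auto
    moreover have "trans L \<sigma> \<tau> q = c \<sigma> \<tau> * q (\<mu> \<sigma> - \<mu> \<tau>)" "c \<sigma> \<sigma>0 = c \<sigma> \<tau> * c \<tau> \<sigma>0"
      "\<mu> \<sigma> - \<mu> \<tau> \<in> dual_monoid \<Delta> (\<sigma> \<inter> \<tau>)"
      using B \<sigma>\<tau> q \<sigma> by (auto simp: monomial_bundle_def)
    moreover have "q (\<mu> \<sigma> - x) = q (\<mu> \<sigma> - \<mu> \<tau>) * q (\<mu> \<tau> - x)"
      using chart_add[OF q calculation(5), of "\<mu> \<tau> - x"] mem[OF \<sigma>\<tau>(2)] dual_monoid_mono[of "\<sigma> \<inter> \<tau>" \<tau>]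
      by auto
    ultimately show ?thesis using \<sigma>\<tau> mem by (simp add: monomial_section_def chart_map_def)
  qed
  ultimately show ?thesis unfolding global_sections_def by (auto simp: monomial_section_def)
qed

text \<open>The expansion over \<sigma>0 determines the one over any other chamber: on the
  exponential points of the overlap, all exponents are shifted by the difference of the vertices.
  That the shifted exponents belong to the other dual monoid is precisely the condition for lattice
  points.\<close>

lemma global_section_expansion:
  assumes B: "monomial_bundle \<Delta> L c \<mu>" and \<sigma>0: "\<sigma>0 \<in> weyl_chambers \<Delta>" and s: "s \<in> global_sections \<Delta> L"
  obtains S e where "finite S" "S \<subseteq> lattice_points \<Delta> \<mu>"
    "s = (\<lambda>\<sigma> p. \<Sum>x\<in>S. e x * monomial_section \<Delta> (\<lambda>\<sigma>. c \<sigma> \<sigma>0) \<mu> x \<sigma> p)"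
proof -
  have "s \<sigma>0 \<in> regular \<Delta> \<sigma>0" using s \<sigma>0 by (auto simp: global_sections_def)
  then obtain A d where A: "finite A" "A \<subseteq> dual_monoid \<Delta> \<sigma>0" "\<And>y. y \<in> A \<Longrightarrow> d y \<noteq> 0"
    "\<And>p. p \<in> chart \<Delta> \<sigma>0 \<Longrightarrow> s \<sigma>0 p = (\<Sum>y\<in>A. d y * p y)"
    by (rule regular_expansion) (rule that)
  have c0: "c \<sigma> \<sigma>0 \<noteq> 0" if "\<sigma> \<in> weyl_chambers \<Delta>" for \<sigma>
  proof -
    have "c \<sigma>0 \<sigma> * c \<sigma> \<sigma>0 = 1" using B \<sigma>0 that by (simp add: monomial_bundle_def)
    then show ?thesis by auto
  qed
  have key: "(\<forall>y\<in>A. y + (\<mu> \<sigma> - \<mu> \<sigma>0) \<in> dual_monoid \<Delta> \<sigma>) \<and>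
      (\<forall>p\<in>chart \<Delta> \<sigma>. s \<sigma> p = (\<Sum>y\<in>A. d y * (c \<sigma> \<sigma>0 * p (y + (\<mu> \<sigma> - \<mu> \<sigma>0)))))"
    if \<sigma>: "\<sigma> \<in> weyl_chambers \<Delta>" for \<sigma>
  proof -
    let ?\<delta> = "\<mu> \<sigma> - \<mu> \<sigma>0"
    have "s \<sigma> \<in> regular \<Delta> \<sigma>" using s \<sigma> by (auto simp: global_sections_def)
    then obtain B' b where B': "finite B'" "B' \<subseteq> dual_monoid \<Delta> \<sigma>" "\<And>y. y \<in> B' \<Longrightarrow> b y \<noteq> 0"
      "\<And>p. p \<in> chart \<Delta> \<sigma> \<Longrightarrow> s \<sigma> p = (\<Sum>y\<in>B'. b y * p y)"
      by (rule regular_expansion) (rule that)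
    have inj: "inj_on (\<lambda>y. y + ?\<delta>) A" by (auto intro: inj_onI)
    have eq: "(\<Sum>y\<in>B'. b y * of_real (exp (v \<bullet> y)))
        = (\<Sum>y\<in>(\<lambda>y. y + ?\<delta>) ` A. c \<sigma> \<sigma>0 * d (y - ?\<delta>) * of_real (exp (v \<bullet> y)))" for v
    proof -
      let ?q = "exp_point (dual_monoid \<Delta> (\<sigma> \<inter> \<sigma>0)) v"
      have "s \<sigma> (chart_map \<Delta> \<sigma> ?q) = trans L \<sigma> \<sigma>0 ?q * s \<sigma>0 (chart_map \<Delta> \<sigma>0 ?q)"
        using s \<sigma> \<sigma>0 exp_point_chart[of "\<sigma> \<inter> \<sigma>0" v] by (simp add: global_sections_def)
      moreover have "trans L \<sigma> \<sigma>0 ?q = c \<sigma> \<sigma>0 * of_real (exp (v \<bullet> ?\<delta>))"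
        using B \<sigma> \<sigma>0 exp_point_chart[of "\<sigma> \<inter> \<sigma>0" v] by (simp add: monomial_bundle_def exp_point_def)
      moreover have "s \<sigma> (chart_map \<Delta> \<sigma> ?q) = (\<Sum>y\<in>B'. b y * of_real (exp (v \<bullet> y)))"
        using B'(2) by (simp add: chart_map_exp_point B'(4)[OF exp_point_chart])
          (auto simp: exp_point_def intro!: sum.cong)
      moreover have "s \<sigma>0 (chart_map \<Delta> \<sigma>0 ?q) = (\<Sum>y\<in>A. d y * of_real (exp (v \<bullet> y)))"
        using A(2) by (simp add: chart_map_exp_point A(4)[OF exp_point_chart])
          (auto simp: exp_point_def intro!: sum.cong)
      ultimately show ?thesis
        by (simp add: sum.reindex[OF inj] sum_distrib_left inner_add_right exp_add mult_ac)
    qed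
    have nz: "c \<sigma> \<sigma>0 * d (y - ?\<delta>) \<noteq> 0" if "y \<in> (\<lambda>y. y + ?\<delta>) ` A" for y
      using that A(3) c0[OF \<sigma>] by auto
    note unique = exp_sums_unique[OF B'(1) finite_imageI[OF A(1)] B'(3) nz eq]
    have "s \<sigma> p = (\<Sum>y\<in>A. d y * (c \<sigma> \<sigma>0 * p (y + ?\<delta>)))" if "p \<in> chart \<Delta> \<sigma>" for p
    proof -
      have "s \<sigma> p = (\<Sum>y\<in>B'. c \<sigma> \<sigma>0 * d (y - ?\<delta>) * p y)"
        unfolding B'(4)[OF that] by (intro sum.cong) (simp_all add: unique(2))
      also have "\<dots> = (\<Sum>y\<in>A. c \<sigma> \<sigma>0 * d y * p (y + ?\<delta>))"
        by (rule sum.reindex_cong[OF inj unique(1)]) simp_all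
      finally show ?thesis by (simp add: mult_ac)
    qed
    moreover have "y + ?\<delta> \<in> dual_monoid \<Delta> \<sigma>" if "y \<in> A" for y
      using that B'(2) unique(1) by blast
    ultimately show ?thesis by blast
  qed
  \<comment> \<open>The monomial with exponent \<open>y\<close> over \<sigma>0 belongs to the
    section of weight \<open>\<mu> \<sigma>0 - y\<close>.\<close>
  define S where "S = (\<lambda>y. \<mu> \<sigma>0 - y) ` A"
  have inj: "inj_on (\<lambda>y. \<mu> \<sigma>0 - y) A" by (auto intro: inj_onI)
  have "s \<sigma> p = (\<Sum>x\<in>S. d (\<mu> \<sigma>0 - x) * monomial_section \<Delta> (\<lambda>\<sigma>. c \<sigma> \<sigma>0) \<mu> x \<sigma> p)" for \<sigma> p
  proof (cases "\<sigma> \<in> weyl_chambers \<Delta> \<and> p \<in> chart \<Delta> \<sigma>")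
    case True
    then show ?thesis using key[of \<sigma>]
      by (simp add: S_def sum.reindex[OF inj] monomial_section_def algebra_simps)
  next
    case False
    then have "s \<sigma> p = 0" using s by (auto simp: global_sections_def)
    then show ?thesis using False by (auto simp: monomial_section_def)
  qed
  then have "s = (\<lambda>\<sigma> p. \<Sum>x\<in>S. d (\<mu> \<sigma>0 - x) * monomial_section \<Delta> (\<lambda>\<sigma>. c \<sigma> \<sigma>0) \<mu> x \<sigma> p)" by blast
  moreover have "S \<subseteq> lattice_points \<Delta> \<mu>"
    using key by (auto simp: S_def lattice_points_def algebra_simps)
  ultimately show ?thesis using A(1) by (intro that[of S]) (auto simp: S_def)
qed

end

section \<open>Ampleness and the vertices\<close>

context reduced_root_system
begin

section \<open>Torus-fixed points of the variety\<close>

lemma gluing_refl: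
  assumes "\<sigma> \<in> weyl_chambers \<Delta>" "p \<in> chart \<Delta> \<sigma>"
  shows "((\<sigma>, p), (\<sigma>, p)) \<in> gluing \<Delta>"
proof -
  have "chart_map \<Delta> \<sigma> p = p" using chart_outside[OF assms(2)] by (auto simp: chart_map_def)
  then show ?thesis
    unfolding gluing_def using assms by (intro CollectI exI[of _ \<sigma>] exI[of _ p]) simp
qed

lemma point_eqD:
  assumes "point \<Delta> \<sigma> p = point \<Delta> \<tau> q" "\<tau> \<in> weyl_chambers \<Delta>" "q \<in> chart \<Delta> \<tau>"
  obtains r where "r \<in> chart \<Delta> (\<sigma> \<inter> \<tau>)" "p = chart_map \<Delta> \<sigma> r" "q = chart_map \<Delta> \<tau> r"
proof -
  have "((\<sigma>, p), (\<tau>, q)) \<in> gluing \<Delta>"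
    using gluing_refl[OF assms(2,3)] assms(1) by (auto simp: point_def)
  then show ?thesis using that by (auto simp: gluing_def)
qed

lemma separating_root:
  assumes u: "regular_vector u" and v: "regular_vector v" and "cone u \<noteq> cone v"
  obtains \<alpha> where "\<alpha> \<in> pos v" "- \<alpha> \<in> pos u"
proof -
  have "\<exists>\<alpha>\<in>pos v. - \<alpha> \<in> pos u"
  proof (rule ccontr)
    assume none: "\<not> (\<exists>\<alpha>\<in>pos v. - \<alpha> \<in> pos u)"
    then have "pos v \<subseteq> pos u" using pos_or_minus[OF u] pos_root by blast
    moreover have "pos u \<subseteq> pos v"
    proof
      fix \<alpha> assume \<alpha>: "\<alpha> \<in> pos u"
      then show "\<alpha> \<in> pos v" using none pos_or_minus[OF v pos_root[OF \<alpha>]] by (metis minus_minus)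
    qed
    ultimately show False using assms(3) by (simp add: cone_def)
  qed
  then show ?thesis using that by blast
qed

text \<open>A root that separates two chambers is invertible on the overlap of their charts, since
  it and its negative are both regular there; but it vanishes at the fixed point of \<tau>.\<close>

lemma point_eq_fixed_point:
  assumes \<sigma>: "\<sigma> \<in> weyl_chambers \<Delta>" and \<tau>: "\<tau> \<in> weyl_chambers \<Delta>"
    and eq: "point \<Delta> \<sigma> p = point \<Delta> \<tau> fixed_point"
  shows "\<sigma> = \<tau>" "p = fixed_point"
proof -
  obtain u where u: "regular_vector u" "\<sigma> = cone u" using \<sigma> by (auto simp: weyl_chambers_eq)
  obtain v where v: "regular_vector v" "\<tau> = cone v" using \<tau> by (auto simp: weyl_chambers_eq)
  obtain r where r: "r \<in> chart \<Delta> (\<sigma> \<inter> \<tau>)" "p = chart_map \<Delta> \<sigma> r" "fixed_point = chart_map \<Delta> \<tau> r"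
    using point_eqD[OF eq \<tau>] fixed_point_chart[OF v(1)] v(2) by blast
  show "\<sigma> = \<tau>"
  proof (rule ccontr)
    assume "\<sigma> \<noteq> \<tau>"
    then obtain \<alpha> where \<alpha>: "\<alpha> \<in> pos v" "- \<alpha> \<in> pos u"
      using separating_root[OF u(1) v(1)] u(2) v(2) by blast
    have mem: "\<alpha> \<in> dual_monoid \<Delta> \<tau>" "- \<alpha> \<in> dual_monoid \<Delta> \<sigma>"
      using pos_dual_monoid[OF \<alpha>(1)] pos_dual_monoid[OF \<alpha>(2)] u(2) v(2) by auto
    have "r (\<alpha> + - \<alpha>) = r \<alpha> * r (- \<alpha>)"
      using mem dual_monoid_mono[of "\<sigma> \<inter> \<tau>"] by (intro chart_add[OF r(1)]) blast+
    then have "r \<alpha> \<noteq> 0" using chart_zero[OF r(1)] by auto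
    moreover have "r \<alpha> = fixed_point \<alpha>" unfolding r(3) using mem(1) by (simp add: chart_map_def)
    ultimately show False using root_nonzero[OF pos_root[OF \<alpha>(1)]] by (simp add: fixed_point_def)
  qed
  then show "p = fixed_point" using r by simp
qed

lemma point_in_toric_variety:
  "\<sigma> \<in> weyl_chambers \<Delta> \<Longrightarrow> p \<in> chart \<Delta> \<sigma> \<Longrightarrow> point \<Delta> \<sigma> p \<in> toric_variety \<Delta>"
  unfolding point_def toric_variety_def by (intro quotientI) simp

text \<open>A single monomial cuts out the neighbourhood: in the chart of \<tau>, a nonconstant one
  that does not vanish at \<open>p\<close>; in any other chart the constant 1, because the fixed
  point of \<tau> is not there.\<close>

lemma fixed_point_complement_open:
  assumes \<tau>: "\<tau> \<in> weyl_chambers \<Delta>"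
  shows "zariski_open \<Delta> (toric_variety \<Delta> - {point \<Delta> \<tau> fixed_point})"
  unfolding zariski_open_def
proof (intro conjI ballI impI)
  fix \<rho> p assume \<rho>: "\<rho> \<in> weyl_chambers \<Delta>" and p: "p \<in> chart \<Delta> \<rho>"
    and U: "point \<Delta> \<rho> p \<in> toric_variety \<Delta> - {point \<Delta> \<tau> fixed_point}"
  have monomial: "(\<lambda>q. q y) \<in> regular \<Delta> \<rho>" if "y \<in> dual_monoid \<Delta> \<rho>" for y
    using that by (intro regularI[of "{()}" "\<lambda>_. y" _ _ "\<lambda>_. 1"]) auto
  obtain y where y: "y \<in> dual_monoid \<Delta> \<rho>" "p y \<noteq> 0" "\<rho> = \<tau> \<Longrightarrow> y \<noteq> 0"
  proof (cases "\<rho> = \<tau>")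
    case True
    then have "p \<noteq> fixed_point" using U by auto
    then obtain y where "p y \<noteq> fixed_point y" by blast
    then have "y \<noteq> 0" "p y \<noteq> 0" using chart_zero[OF p] by (auto simp: fixed_point_def split: if_splits)
    then show ?thesis using that chart_outside[OF p] by blast
  next
    case False
    then show ?thesis using that[OF dual_monoid_zero] chart_zero[OF p] by simp
  qed
  have "point \<Delta> \<rho> q \<noteq> point \<Delta> \<tau> fixed_point" if "q y \<noteq> 0" for q
    using point_eq_fixed_point[OF \<rho> \<tau>, of q] y(3) that by (auto simp: fixed_point_def)
  then show "\<exists>f\<in>regular \<Delta> \<rho>. f p \<noteq> 0 \<and>
      (\<forall>q\<in>chart \<Delta> \<rho>. f q \<noteq> 0 \<longrightarrow> point \<Delta> \<rho> q \<in> toric_variety \<Delta> - {point \<Delta> \<tau> fixed_point})"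
    using monomial[OF y(1)] y(2) point_in_toric_variety[OF \<rho>] by (intro bexI[of _ "\<lambda>q. q y"]) auto
qed auto

lemma ample_separates_fixed_points:
  assumes "ample \<Delta> L" and \<sigma>: "\<sigma> \<in> weyl_chambers \<Delta>" and \<tau>: "\<tau> \<in> weyl_chambers \<Delta>" and "\<sigma> \<noteq> \<tau>"
  obtains k s where "k \<ge> 1" "s \<in> global_sections \<Delta> (bundle_power L k)"
    "s \<sigma> fixed_point \<noteq> 0" "s \<tau> fixed_point = 0"
proof -
  have chart: "fixed_point \<in> chart \<Delta> \<rho>" if "\<rho> \<in> weyl_chambers \<Delta>" for \<rho>
    using that fixed_point_chart by (auto simp: weyl_chambers_eq)
  let ?U = "toric_variety \<Delta> - {point \<Delta> \<tau> fixed_point}"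
  have "point \<Delta> \<sigma> fixed_point \<in> ?U"
    using point_in_toric_variety[OF \<sigma> chart[OF \<sigma>]] point_eq_fixed_point(1)[OF \<sigma> \<tau>] assms(4) by blast
  then obtain k s where k: "k \<ge> 1" and s: "s \<in> global_sections \<Delta> (bundle_power L k)"
    and P: "point \<Delta> \<sigma> fixed_point \<in> nonvanishing_locus \<Delta> s" and U: "nonvanishing_locus \<Delta> s \<subseteq> ?U"
    using assms(1) fixed_point_complement_open[OF \<tau>] unfolding ample_def by meson
  obtain \<rho> p where \<rho>: "\<rho> \<in> weyl_chambers \<Delta>" "s \<rho> p \<noteq> 0" "point \<Delta> \<rho> p = point \<Delta> \<sigma> fixed_point"
    using P by (auto simp: nonvanishing_locus_def)
  \<comment> \<open>The nonvanishing locus only provides some representative of the point; a fixed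
    point has just one.\<close>
  then have "s \<sigma> fixed_point \<noteq> 0" using point_eq_fixed_point[OF \<rho>(1) \<sigma> \<rho>(3)] by simp
  moreover have "s \<tau> fixed_point = 0"
  proof (rule ccontr)
    assume "s \<tau> fixed_point \<noteq> 0"
    then have "point \<Delta> \<tau> fixed_point \<in> nonvanishing_locus \<Delta> s"
      using \<tau> chart[OF \<tau>] by (auto simp: nonvanishing_locus_def)
    then show False using U by blast
  qed
  ultimately show ?thesis using that k s by blast
qed

text \<open>At the fixed point of \<rho> every monomial section vanishes except the one at the
  vertex of \<rho>. A section of a power that is nonzero at \<sigma> thus contains the scaled vertex
  of \<sigma>; if it is also zero at \<tau>, the vertices cannot coincide.\<close>

lemma ample_vertices:
  assumes B: "monomial_bundle \<Delta> L c \<mu>" and ample: "ample \<Delta> L"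
    and \<sigma>: "\<sigma> \<in> weyl_chambers \<Delta>" and \<tau>: "\<tau> \<in> weyl_chambers \<Delta>" and "\<sigma> \<noteq> \<tau>"
  shows "\<mu> \<sigma> \<in> lattice_points \<Delta> \<mu>" "\<mu> \<sigma> \<noteq> \<mu> \<tau>"
proof -
  have chart: "fixed_point \<in> chart \<Delta> \<rho>" if "\<rho> \<in> weyl_chambers \<Delta>" for \<rho>
    using that fixed_point_chart by (auto simp: weyl_chambers_eq)
  obtain k s where k: "k \<ge> 1" and s: "s \<in> global_sections \<Delta> (bundle_power L k)"
    and s\<sigma>: "s \<sigma> fixed_point \<noteq> 0" and s\<tau>: "s \<tau> fixed_point = 0"
    using ample_separates_fixed_points[OF ample \<sigma> \<tau> assms(5)] by blast
  let ?\<mu> = "\<lambda>\<sigma>. real k *\<^sub>R \<mu> \<sigma>"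
  obtain S e where S: "finite S" "S \<subseteq> lattice_points \<Delta> ?\<mu>"
    "s = (\<lambda>\<rho> p. \<Sum>x\<in>S. e x * monomial_section \<Delta> (\<lambda>\<rho>. c \<rho> \<sigma> ^ k) ?\<mu> x \<rho> p)"
    using global_section_expansion[OF monomial_bundle_power[OF B] \<sigma> s] by blast
  have s_fixed: "s \<rho> fixed_point = c \<rho> \<sigma> ^ k * (if ?\<mu> \<rho> \<in> S then e (?\<mu> \<rho>) else 0)"
    if "\<rho> \<in> weyl_chambers \<Delta>" for \<rho>
  proof -
    have "s \<rho> fixed_point = (\<Sum>x\<in>S. if x = ?\<mu> \<rho> then c \<rho> \<sigma> ^ k * e x else 0)"
      unfolding S(3) using that chart[OF that]
      by (intro sum.cong) (auto simp: monomial_section_def fixed_point_def)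
    then show ?thesis using S(1) by simp
  qed
  have "?\<mu> \<sigma> \<in> lattice_points \<Delta> ?\<mu>"
    using s\<sigma> S(2) by (auto simp: s_fixed[OF \<sigma>] split: if_splits)
  then have scaled: "real k *\<^sub>R (\<mu> \<rho> - \<mu> \<sigma>) \<in> dual_monoid \<Delta> \<rho>" if "\<rho> \<in> weyl_chambers \<Delta>" for \<rho>
    using that by (simp add: lattice_points_def scaleR_diff_right)
  have "\<mu> \<rho> - \<mu> \<sigma> \<in> dual_monoid \<Delta> \<rho>" if \<rho>: "\<rho> \<in> weyl_chambers \<Delta>" for \<rho>
  proof -
    \<comment> \<open>The inequalities can be divided by \<open>k\<close>, but membership in the
      root lattice cannot; it comes from the transition functions.\<close>
    have "\<mu> \<rho> - \<mu> \<sigma> \<in> root_lattice \<Delta>" using B \<sigma> \<rho> by (simp add: monomial_bundle_def dual_monoid_def)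
    moreover have "0 \<le> v \<bullet> (\<mu> \<rho> - \<mu> \<sigma>)" if "v \<in> \<rho>" for v
    proof -
      have "0 \<le> real k * (v \<bullet> (\<mu> \<rho> - \<mu> \<sigma>))"
        using scaled[OF \<rho>] that unfolding dual_monoid_def inner_scaleR_right[symmetric] by blast
      then show ?thesis using k by (simp add: zero_le_mult_iff)
    qed
    ultimately show ?thesis by (simp add: dual_monoid_def)
  qed
  then show "\<mu> \<sigma> \<in> lattice_points \<Delta> \<mu>" by (simp add: lattice_points_def)
  show "\<mu> \<sigma> \<noteq> \<mu> \<tau>"
  proof
    assume eq: "\<mu> \<sigma> = \<mu> \<tau>"
    have "c \<sigma> \<tau> * c \<tau> \<sigma> = 1" using B \<sigma> \<tau> by (simp add: monomial_bundle_def)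
    then have "c \<tau> \<sigma> \<noteq> 0" by auto
    then show False using s\<sigma> s\<tau> by (simp add: s_fixed[OF \<sigma>] s_fixed[OF \<tau>] eq split: if_splits)
  qed
qed

end

section \<open>The multiplication map\<close>

text \<open>\<open>multiply\<close> sums over the support of its argument; a common finite set of
  indices is what makes linearity accessible.\<close>

lemma multiply_superset:
  assumes "finite W" "\<And>w. \<phi> w \<noteq> 0 \<Longrightarrow> w \<in> W"
  shows "multiply \<phi> \<sigma> p = (\<Sum>w\<in>W. \<phi> w * (\<Prod>s\<leftarrow>w. s \<sigma> p))"
  unfolding multiply_def using assms by (intro sum.mono_neutral_left) auto

lemma multiply_linear:
  assumes "finite {w. \<phi> w \<noteq> 0}" "finite {w. \<psi> w \<noteq> 0}"
  shows "finite {w. a * \<phi> w + b * \<psi> w \<noteq> 0}"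
    "multiply (\<lambda>w. a * \<phi> w + b * \<psi> w) \<sigma> p = a * multiply \<phi> \<sigma> p + b * multiply \<psi> \<sigma> p"
proof -
  let ?W = "{w. \<phi> w \<noteq> 0} \<union> {w. \<psi> w \<noteq> 0}"
  have fin: "finite ?W" using assms by simp
  then show "finite {w. a * \<phi> w + b * \<psi> w \<noteq> 0}" by (rule rev_finite_subset) auto
  have "multiply (\<lambda>w. a * \<phi> w + b * \<psi> w) \<sigma> p = (\<Sum>w\<in>?W. (a * \<phi> w + b * \<psi> w) * (\<Prod>s\<leftarrow>w. s \<sigma> p))"
    by (rule multiply_superset[OF fin]) auto
  also have "\<dots> = a * (\<Sum>w\<in>?W. \<phi> w * (\<Prod>s\<leftarrow>w. s \<sigma> p)) + b * (\<Sum>w\<in>?W. \<psi> w * (\<Prod>s\<leftarrow>w. s \<sigma> p))"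
    by (simp only: sum_distrib_left sum.distrib[symmetric] distrib_right mult.assoc)
  also have "\<dots> = a * multiply \<phi> \<sigma> p + b * multiply \<psi> \<sigma> p"
    using multiply_superset[OF fin, of \<phi> \<sigma> p] multiply_superset[OF fin, of \<psi> \<sigma> p] by simp
  finally show "multiply (\<lambda>w. a * \<phi> w + b * \<psi> w) \<sigma> p = a * multiply \<phi> \<sigma> p + b * multiply \<psi> \<sigma> p" .
qed

lemma finite_support_basis_vector: "finite {v. basis_vector w v \<noteq> 0}"
  by (simp add: basis_vector_def)

lemma multiply_basis_vector: "multiply (basis_vector w) \<sigma> p = (\<Prod>s\<leftarrow>w. s \<sigma> p)"
proof -
  have "multiply (basis_vector w) \<sigma> p = (\<Sum>v\<in>{w}. basis_vector w v * (\<Prod>s\<leftarrow>v. s \<sigma> p))"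
    by (rule multiply_superset) (simp_all add: basis_vector_def split: if_splits)
  then show ?thesis by (simp add: basis_vector_def)
qed

text \<open>The kernel \<open>?T\<close> is a subspace that contains the generators. Finite support
  is part of it because \<open>multiply_linear\<close> rests on it.\<close>

lemma multilinear_relations_multiply:
  fixes H :: "'a bundle_section set"
  assumes "\<phi> \<in> multilinear_relations m H"
  shows "finite {w. \<phi> w \<noteq> 0}" "multiply \<phi> \<sigma> p = 0"
proof -
  interpret free: module "\<lambda>(c::complex) (\<phi> :: 'a bundle_section list \<Rightarrow> complex) w. c * \<phi> w"
    by standard (auto simp: fun_eq_iff algebra_simps)
  let ?T = "{\<phi> :: 'a bundle_section list \<Rightarrow> complex. finite {w. \<phi> w \<noteq> 0} \<and> (\<forall>\<sigma> p. multiply \<phi> \<sigma> p = 0)}"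
  have comb: "(\<lambda>w. a * \<phi> w + b * \<psi> w) \<in> ?T" if "\<phi> \<in> ?T" "\<psi> \<in> ?T" for a b \<phi> \<psi>
    using that multiply_linear[of \<phi> \<psi> a b] by simp
  have T: "free.subspace ?T"
    unfolding free.subspace_def
  proof (intro conjI ballI allI)
    show "0 \<in> ?T" by (simp add: multiply_def)
    show "\<phi> + \<psi> \<in> ?T" if "\<phi> \<in> ?T" "\<psi> \<in> ?T" for \<phi> \<psi>
      using comb[OF that, of 1 1] by (simp add: plus_fun_def)
    show "(\<lambda>w. c * \<phi> w) \<in> ?T" if "\<phi> \<in> ?T" for c \<phi>
      using comb[OF that that, of c 0] by simp
  qed
  have add: "basis_vector (u @ (a + b) # v) - basis_vector (u @ a # v) - basis_vector (u @ b # v) \<in> ?T"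
    for u v and a b :: "'a bundle_section"
  proof -
    let ?x = "basis_vector (u @ (a + b) # v)" and ?y = "basis_vector (u @ a # v)" and ?z = "basis_vector (u @ b # v)"
    note xy = multiply_linear[OF finite_support_basis_vector finite_support_basis_vector,
        of 1 "u @ (a + b) # v" "-1" "u @ a # v"]
    note xyz = multiply_linear[OF xy(1) finite_support_basis_vector, of 1 "-1" "u @ b # v"]
    have "?x - ?y - ?z = (\<lambda>w. 1 * (1 * ?x w + - 1 * ?y w) + - 1 * ?z w)" by (simp add: fun_eq_iff)
    moreover have "multiply (\<lambda>w. 1 * (1 * ?x w + - 1 * ?y w) + - 1 * ?z w) \<sigma> p = 0" for \<sigma> p
      unfolding xyz(2) xy(2) by (simp add: multiply_basis_vector algebra_simps)
    ultimately show ?thesis using xyz(1) by simp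
  qed
  have scale: "(\<lambda>w. basis_vector (u @ (\<lambda>\<sigma> p. c * a \<sigma> p) # v) w - c * basis_vector (u @ a # v) w) \<in> ?T"
    for u v c and a :: "'a bundle_section"
  proof -
    note xy = multiply_linear[OF finite_support_basis_vector finite_support_basis_vector,
        of 1 "u @ (\<lambda>\<sigma> p. c * a \<sigma> p) # v" "- c" "u @ a # v"]
    then show ?thesis by (simp add: multiply_basis_vector)
  qed
  have "multilinear_relations m H \<subseteq> ?T"
    unfolding multilinear_relations_def by (rule free.span_minimal[OF _ T]) (use add scale in blast)
  then show "finite {w. \<phi> w \<noteq> 0}" "multiply \<phi> \<sigma> p = 0" using assms by auto
qed

text \<open>Members of a class differ by a relation, which \<open>multiply\<close> kills. So each
  class has a one-element image, as \<open>the_elem\<close> requires.\<close>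

lemma canonical_map_image: "canonical_map ` tensor_power m H = multiply ` free_space m H"
proof -
  define R where "R = {(\<phi>, \<psi>). \<phi> \<in> free_space m H \<and> \<psi> \<in> free_space m H \<and> \<phi> - \<psi> \<in> multilinear_relations m H}"
  have "canonical_map (R `` {\<phi>}) = multiply \<phi>" if \<phi>: "\<phi> \<in> free_space m H" for \<phi>
  proof -
    interpret free: module "\<lambda>(c::complex) (\<phi> :: 'a bundle_section list \<Rightarrow> complex) w. c * \<phi> w"
      by standard (auto simp: fun_eq_iff algebra_simps)
    have "\<phi> \<in> R `` {\<phi>}" using \<phi> free.span_zero by (auto simp: R_def multilinear_relations_def)
    moreover have "multiply \<psi> = multiply \<phi>" if "\<psi> \<in> R `` {\<phi>}" for \<psi>
    proof (intro ext)
      fix \<sigma> p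
      have fin: "finite {w. \<phi> w \<noteq> 0}" "finite {w. \<psi> w \<noteq> 0}" using \<phi> that by (auto simp: R_def free_space_def)
      have "multiply (\<phi> - \<psi>) \<sigma> p = 0" using that multilinear_relations_multiply(2) unfolding R_def by blast
      then show "multiply \<psi> \<sigma> p = multiply \<phi> \<sigma> p"
        using multiply_linear(2)[OF fin, of 1 "-1" \<sigma> p] by (simp add: fun_diff_def)
    qed
    ultimately have "multiply ` (R `` {\<phi>}) = {multiply \<phi>}" by blast
    then show ?thesis by (simp add: canonical_map_def)
  qed
  then have "(\<lambda>\<phi>. canonical_map (R `` {\<phi>})) ` free_space m H = multiply ` free_space m H" by (rule image_cong[OF refl])
  moreover have "tensor_power m H = (\<lambda>\<phi>. R `` {\<phi>}) ` free_space m H"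
    unfolding tensor_power_def R_def[symmetric] quotient_def by (rule UNION_singleton_eq_range)
  ultimately show ?thesis by (simp only: image_image)
qed

section \<open>Regularity and products of sections\<close>

context reduced_root_system
begin

lemma regular_mult:
  assumes "f \<in> regular \<Delta> \<tau>" "g \<in> regular \<Delta> \<tau>"
  shows "(\<lambda>p. f p * g p) \<in> regular \<Delta> \<tau>"
proof -
  obtain A c where A: "finite A" "A \<subseteq> dual_monoid \<Delta> \<tau>" "\<And>p. p \<in> chart \<Delta> \<tau> \<Longrightarrow> f p = (\<Sum>y\<in>A. c y * p y)"
    using assms(1) by (auto simp: regular_def)
  obtain B d where B: "finite B" "B \<subseteq> dual_monoid \<Delta> \<tau>" "\<And>p. p \<in> chart \<Delta> \<tau> \<Longrightarrow> g p = (\<Sum>y\<in>B. d y * p y)"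
    using assms(2) by (auto simp: regular_def)
  show ?thesis
  proof (rule regularI[of "A \<times> B" "\<lambda>(y, z). y + z" _ _ "\<lambda>(y, z). c y * d z"])
    fix p assume p: "p \<in> chart \<Delta> \<tau>"
    have "f p * g p = (\<Sum>(y, z)\<in>A \<times> B. (c y * p y) * (d z * p z))"
      by (simp add: A(3)[OF p] B(3)[OF p] sum_product sum.cartesian_product)
    also have "\<dots> = (\<Sum>i\<in>A \<times> B. (case i of (y, z) \<Rightarrow> c y * d z) * p (case i of (y, z) \<Rightarrow> y + z))"
      using A(2) B(2) by (intro sum.cong) (auto simp: chart_add[OF p] subset_iff)
    finally show "f p * g p = (\<Sum>i\<in>A \<times> B. (case i of (y, z) \<Rightarrow> c y * d z) * p (case i of (y, z) \<Rightarrow> y + z))" .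
  qed (use A B in \<open>auto intro: dual_monoid_add\<close>)
qed

lemma regular_const: "(\<lambda>_. a) \<in> regular \<Delta> \<tau>"
  by (rule regularI[of "{()}" "\<lambda>_. 0" _ _ "\<lambda>_. a"]) (auto simp: dual_monoid_zero chart_zero)

lemma regular_add:
  assumes "f \<in> regular \<Delta> \<tau>" "g \<in> regular \<Delta> \<tau>"
  shows "(\<lambda>p. f p + g p) \<in> regular \<Delta> \<tau>"
proof -
  obtain A c where A: "finite A" "A \<subseteq> dual_monoid \<Delta> \<tau>" "\<And>p. p \<in> chart \<Delta> \<tau> \<Longrightarrow> f p = (\<Sum>y\<in>A. c y * p y)"
    using assms(1) by (auto simp: regular_def)
  obtain B d where B: "finite B" "B \<subseteq> dual_monoid \<Delta> \<tau>" "\<And>p. p \<in> chart \<Delta> \<tau> \<Longrightarrow> g p = (\<Sum>y\<in>B. d y * p y)"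
    using assms(2) by (auto simp: regular_def)
  show ?thesis
    by (rule regularI[of "A <+> B" "case_sum id id" _ _ "case_sum c d"])
      (use A B in \<open>auto simp: sum.Plus\<close>)
qed

lemma regular_sum:
  "finite I \<Longrightarrow> (\<And>i. i \<in> I \<Longrightarrow> f i \<in> regular \<Delta> \<tau>) \<Longrightarrow> (\<lambda>p. \<Sum>i\<in>I. f i p) \<in> regular \<Delta> \<tau>"
  by (induction I rule: finite_induct) (auto intro: regular_const regular_add)

lemma regular_prod_list:
  "(\<And>s. s \<in> set w \<Longrightarrow> s \<sigma> \<in> regular \<Delta> \<tau>) \<Longrightarrow> (\<lambda>p. \<Prod>s\<leftarrow>w. s \<sigma> p) \<in> regular \<Delta> \<tau>"
  by (induction w) (auto intro: regular_const regular_mult)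

lemma multiply_global_section:
  assumes \<phi>: "\<phi> \<in> free_space m (global_sections \<Delta> L)" and "m \<ge> 1"
  shows "multiply \<phi> \<in> global_sections \<Delta> (bundle_power L m)"
proof -
  let ?W = "{w. \<phi> w \<noteq> 0}"
  have fin: "finite ?W" and W: "\<And>w. w \<in> ?W \<Longrightarrow> length w = m \<and> set w \<subseteq> global_sections \<Delta> L"
    using \<phi> by (auto simp: free_space_def)
  have "multiply \<phi> \<sigma> \<in> regular \<Delta> \<sigma>" if "\<sigma> \<in> weyl_chambers \<Delta>" for \<sigma>
    unfolding multiply_def
  proof (intro regular_sum fin regular_mult regular_const regular_prod_list)
    fix w s assume "w \<in> ?W" "s \<in> set w"
    then have "s \<in> global_sections \<Delta> L" using W by blast
    then show "s \<sigma> \<in> regular \<Delta> \<sigma>" using that by (simp add: global_sections_def)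
  qed
  moreover have "multiply \<phi> \<sigma> (chart_map \<Delta> \<sigma> q) = trans (bundle_power L m) \<sigma> \<tau> q * multiply \<phi> \<tau> (chart_map \<Delta> \<tau> q)"
    if "\<sigma> \<in> weyl_chambers \<Delta>" "\<tau> \<in> weyl_chambers \<Delta>" "q \<in> chart \<Delta> (\<sigma> \<inter> \<tau>)" for \<sigma> \<tau> q
  proof -
    have "(\<Prod>s\<leftarrow>w. s \<sigma> (chart_map \<Delta> \<sigma> q)) = trans L \<sigma> \<tau> q ^ length w * (\<Prod>s\<leftarrow>w. s \<tau> (chart_map \<Delta> \<tau> q))"
      if "set w \<subseteq> global_sections \<Delta> L" for w
      using that \<open>\<sigma> \<in> weyl_chambers \<Delta>\<close> \<open>\<tau> \<in> weyl_chambers \<Delta>\<close> \<open>q \<in> chart \<Delta> (\<sigma> \<inter> \<tau>)\<close>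
      by (induction w) (auto simp: global_sections_def)
    then have "(\<Prod>s\<leftarrow>w. s \<sigma> (chart_map \<Delta> \<sigma> q)) = trans L \<sigma> \<tau> q ^ m * (\<Prod>s\<leftarrow>w. s \<tau> (chart_map \<Delta> \<tau> q))"
      if "w \<in> ?W" for w using W[OF that] by blast
    then show ?thesis
      unfolding multiply_def sum_distrib_left by (intro sum.cong) (simp_all add: bundle_power_def)
  qed
  moreover have "multiply \<phi> \<sigma> p = 0" if "\<not> (\<sigma> \<in> weyl_chambers \<Delta> \<and> p \<in> chart \<Delta> \<sigma>)" for \<sigma> p
    unfolding multiply_def
  proof (intro sum.neutral ballI)
    fix w assume w: "w \<in> ?W"
    \<comment> \<open>Since \<open>m \<ge> 1\<close>, the product has a factor that is 0 outside the
      charts; an empty product would be 1.\<close>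
    then obtain s u where "w = s # u" using W[OF w] assms(2) by (cases w) auto
    moreover have "s \<in> global_sections \<Delta> L" using W[OF w] \<open>w = s # u\<close> by simp
    then have "s \<sigma> p = 0" using that unfolding global_sections_def by blast
    ultimately show "\<phi> w * (\<Prod>s\<leftarrow>w. s \<sigma> p) = 0" by simp
  qed
  ultimately show ?thesis unfolding global_sections_def by blast
qed

text \<open>Membership of the exponent in the dual monoid is proved along with the formula because
  multiplicativity of \<open>p\<close> needs it at each step.\<close>

lemma prod_list_monomial_sections:
  assumes \<sigma>: "\<sigma> \<in> weyl_chambers \<Delta>" and p: "p \<in> chart \<Delta> \<sigma>" and "set ys \<subseteq> lattice_points \<Delta> \<mu>"
  shows "(\<Prod>s\<leftarrow>map (monomial_section \<Delta> c \<mu>) ys. s \<sigma> p)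
      = c \<sigma> ^ length ys * p (real (length ys) *\<^sub>R \<mu> \<sigma> - sum_list ys)
    \<and> real (length ys) *\<^sub>R \<mu> \<sigma> - sum_list ys \<in> dual_monoid \<Delta> \<sigma>"
  using assms(3)
proof (induction ys)
  case Nil
  then show ?case by (simp add: chart_zero[OF p] dual_monoid_zero)
next
  case (Cons y ys)
  let ?z = "real (length ys) *\<^sub>R \<mu> \<sigma> - sum_list ys"
  have y: "\<mu> \<sigma> - y \<in> dual_monoid \<Delta> \<sigma>" using Cons.prems \<sigma> by (auto simp: lattice_points_def)
  have z: "?z \<in> dual_monoid \<Delta> \<sigma>" using Cons by simp
  have sum: "real (length (y # ys)) *\<^sub>R \<mu> \<sigma> - sum_list (y # ys) = (\<mu> \<sigma> - y) + ?z" by (simp add: algebra_simps)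
  have "monomial_section \<Delta> c \<mu> y \<sigma> p = c \<sigma> * p (\<mu> \<sigma> - y)" using \<sigma> p by (simp add: monomial_section_def)
  moreover have "(\<Prod>s\<leftarrow>map (monomial_section \<Delta> c \<mu>) ys. s \<sigma> p) = c \<sigma> ^ length ys * p ?z" using Cons by simp
  ultimately show ?case
    unfolding sum chart_add[OF p y z] using dual_monoid_add[OF y z] by simp
qed

end

theorem corollary1p2:
  fixes \<Delta> :: "'a::euclidean_space set" and L :: "'a torus_bundle" and m :: nat
  assumes "root_system \<Delta>" and "reduced_roots \<Delta>" and "irreducible_roots \<Delta>"
    and "special_ample \<Delta> L"
    and "m \<ge> 1"
  shows "canonical_map ` tensor_power m (global_sections \<Delta> L)
           = global_sections \<Delta> (bundle_power L m)"
  unfolding canonical_map_image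
proof
  interpret reduced_root_system \<Delta> using assms(1,2) by unfold_locales
  show "multiply ` free_space m (global_sections \<Delta> L) \<subseteq> global_sections \<Delta> (bundle_power L m)"
    using multiply_global_section[OF _ assms(5)] by blast
  obtain \<mu> where L: "equivariant_line_bundle \<Delta> L" "ample \<Delta> L"
    and \<mu>: "polytope_vertices \<Delta> L \<mu>" "\<forall>\<sigma>\<in>weyl_chambers \<Delta>. dominant \<Delta> \<sigma> (\<mu> \<sigma>)"
    using assms(4) by (auto simp: special_ample_def)
  obtain c where B: "monomial_bundle \<Delta> L c \<mu>" using equivariant_monomial_bundle[OF L(1) \<mu>(1)] .
  interpret special_polytope \<Delta> \<mu>
  proof
    fix \<sigma> assume \<sigma>: "\<sigma> \<in> weyl_chambers \<Delta>"
    show "\<mu> \<sigma> \<in> weight_lattice \<Delta>" using \<mu>(1) \<sigma> by (simp add: polytope_vertices_def)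
    show "dominant \<Delta> \<sigma> (\<mu> \<sigma>)" using \<mu>(2) \<sigma> by blast
    show "\<mu> \<sigma> \<in> lattice_points \<Delta> \<mu>"
      using exists_adjacent_chamber[OF \<sigma>] ample_vertices(1)[OF B L(2) \<sigma>] by metis
    show "\<mu> \<sigma> \<noteq> \<mu> \<tau>" if "\<tau> \<in> weyl_chambers \<Delta>" "\<sigma> \<noteq> \<tau>" for \<tau>
      using ample_vertices(2)[OF B L(2) \<sigma> that] .
  qed
  show "global_sections \<Delta> (bundle_power L m) \<subseteq> multiply ` free_space m (global_sections \<Delta> L)"
  proof
    fix s assume s: "s \<in> global_sections \<Delta> (bundle_power L m)"
    obtain \<sigma>0 where \<sigma>0: "\<sigma>0 \<in> weyl_chambers \<Delta>" using exists_regular cone_chamber by blast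
    let ?\<mu> = "\<lambda>\<sigma>. real m *\<^sub>R \<mu> \<sigma>"
    obtain S e where S: "finite S" "S \<subseteq> lattice_points \<Delta> ?\<mu>"
      "s = (\<lambda>\<sigma> p. \<Sum>x\<in>S. e x * monomial_section \<Delta> (\<lambda>\<sigma>. c \<sigma> \<sigma>0 ^ m) ?\<mu> x \<sigma> p)"
      using global_section_expansion[OF monomial_bundle_power[OF B] \<sigma>0 s] by blast
    have "\<forall>x\<in>S. \<exists>ys. length ys = m \<and> set ys \<subseteq> lattice_points \<Delta> \<mu> \<and> sum_list ys = x"
      using S(2) lattice_points_sum by (metis subsetD)
    then obtain ys where ys: "\<And>x. x \<in> S \<Longrightarrow> length (ys x) = m"
      "\<And>x. x \<in> S \<Longrightarrow> set (ys x) \<subseteq> lattice_points \<Delta> \<mu>" "\<And>x. x \<in> S \<Longrightarrow> sum_list (ys x) = x"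
      by metis
    define w where "w = (\<lambda>x. map (monomial_section \<Delta> (\<lambda>\<sigma>. c \<sigma> \<sigma>0) \<mu>) (ys x))"
    \<comment> \<open>Written as a sum over \<open>S\<close>, so coefficients simply add up should
      two points give the same list.\<close>
    define \<phi> where "\<phi> = (\<lambda>v. \<Sum>x\<in>S. e x * basis_vector (w x) v)"
    have supp: "v \<in> w ` S" if "\<phi> v \<noteq> 0" for v
    proof (rule ccontr)
      assume "v \<notin> w ` S"
      then have "\<phi> v = 0" unfolding \<phi>_def by (intro sum.neutral) (auto simp: basis_vector_def)
      with that show False by simp
    qed
    have "w x \<in> {v. length v = m \<and> set v \<subseteq> global_sections \<Delta> L}" if "x \<in> S" for x
      using ys(1,2)[OF that] monomial_section_global[OF B \<sigma>0] by (auto simp: w_def)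
    then have "\<phi> \<in> free_space m (global_sections \<Delta> L)"
      using supp finite_subset[of "{v. \<phi> v \<noteq> 0}" "w ` S"] S(1) by (fastforce simp: free_space_def)
    moreover have "multiply \<phi> \<sigma> p = s \<sigma> p" for \<sigma> p
    proof -
      have "multiply \<phi> \<sigma> p = (\<Sum>v\<in>w ` S. \<phi> v * (\<Prod>s\<leftarrow>v. s \<sigma> p))"
        using S(1) supp by (intro multiply_superset) auto
      also have "\<dots> = (\<Sum>x\<in>S. \<Sum>v\<in>w ` S. e x * basis_vector (w x) v * (\<Prod>s\<leftarrow>v. s \<sigma> p))"
        unfolding \<phi>_def sum_distrib_right by (rule sum.swap)
      also have "\<dots> = (\<Sum>x\<in>S. e x * (\<Prod>s\<leftarrow>w x. s \<sigma> p))"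
      proof (intro sum.cong refl)
        fix x assume "x \<in> S"
        then show "(\<Sum>v\<in>w ` S. e x * basis_vector (w x) v * (\<Prod>s\<leftarrow>v. s \<sigma> p)) = e x * (\<Prod>s\<leftarrow>w x. s \<sigma> p)"
          using S(1) by (subst sum.remove[of _ "w x"]) (auto simp: basis_vector_def intro!: sum.neutral)
      qed
      also have "\<dots> = s \<sigma> p"
        unfolding S(3)
      proof (intro sum.cong refl)
        fix x assume x: "x \<in> S"
        have "(\<Prod>s\<leftarrow>w x. s \<sigma> p) = monomial_section \<Delta> (\<lambda>\<sigma>. c \<sigma> \<sigma>0 ^ m) ?\<mu> x \<sigma> p"
        proof (cases "\<sigma> \<in> weyl_chambers \<Delta> \<and> p \<in> chart \<Delta> \<sigma>")
          case True
          then show ?thesis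
            using prod_list_monomial_sections[of \<sigma> p "ys x" \<mu> "\<lambda>\<sigma>. c \<sigma> \<sigma>0"] ys[OF x]
            by (simp add: w_def monomial_section_def)
        next
          case False
          \<comment> \<open>Both sides are 0 outside the charts: \<open>m \<ge> 1\<close> makes the
            list nonempty.\<close>
          then show ?thesis
            using ys(1)[OF x] assms(5) by (cases "ys x") (auto simp: w_def monomial_section_def)
        qed
        then show "e x * (\<Prod>s\<leftarrow>w x. s \<sigma> p) = e x * monomial_section \<Delta> (\<lambda>\<sigma>. c \<sigma> \<sigma>0 ^ m) ?\<mu> x \<sigma> p" by simp
      qed
      finally show ?thesis .
    qed
    then have "s = multiply \<phi>" by (intro ext) simp
    ultimately show "s \<in> multiply ` free_space m (global_sections \<Delta> L)" by blast
  qed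
qed

end
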